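(* There is an algorithm for $m$-RCSP running in time $\mathrm{poly}(n^m,\gamma_1,\dots,\gamma_m,1/|\varepsilon_1|,\dots,1/|\varepsilon_m|)$ which is a $(1;1+\varepsilon_1,\dots,1+\varepsilon_m)$-approximation scheme: given tolerances $\varepsilon_1,\dots,\varepsilon_m$ with $L_i\varepsilon_i>0$ for all $i$, it finds (whenever a path satisfying all resource constraints exists) an $s\leadsto t$ path $P$ with $c(P)\le \mathrm{OPT}_{RCSP}$ and $\sum_{e\in P}w_i(e)\le(1+\varepsilon_i)L_i$ for all $i\in[m]$. When $\gamma_i,1/|\varepsilon_i|\in\mathrm{poly}(n)$ for all $i$ and $m$ is a constant, it runs in polynomial time.
   Context: $m$-Resource-constrained Shortest Path ($m$-RCSP): input is an $n$-vertex directed graph $G=(V,E)$ with edge costs $c:E\to\mathbb{R}_{\ge0}$, a pair $s,t\in V$, a budget vector $(L_1,\dots,L_m)\in(\mathbb{R}\setminus\{0\})^m$, and for each edge $e$ a resource vector $(w_1(e),\dots,w_m(e))\in\mathbb{R}^m$ (entries may be negative), such that for each $i$ there is no directed cycle of negative total $w_i$-weight. The goal is a minimum-cost $s\leadsto t$ path $P$ (cost $c(P)=\sum_{e\in P}c(e)$) with $\sum_{e\in P}w_i(e)\le L_i$ for all $i$; $\mathrm{OPT}_{RCSP}$ is the cost of such an optimal path. Condition numbers: $\gamma_i=|\min\{\min_{e\in E}w_i(e),0\}|/|L_i|$. *)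

theory Defs
  imports Complex_Main "Graph_Theory.Pair_Digraph"
begin

section \<open>Model of computation: a real-number pointer machine\<close>

text \<open>
  The inputs contain arbitrary real numbers, so running time is counted in the real-number
  (unit cost) model: storing, comparing, adding, subtracting, multiplying and dividing reals
  takes one step each. There is no rounding, no integer division and no test on reals but
  \<open><\<close>, and the only constants are 0 and 1, so that a program cannot hide information in a real
  constant. Memory consists of immutable list cells that are built and inspected at unit cost.
  Programs are finite systems of first-order, call-by-value recursive functions over such data;
  up to polynomial overhead this is the real RAM without a floor operation.
\<close>

datatype val = VNum real | VNil | VCons val val

text \<open>
  Variables are de Bruijn indices into the environment: \<open>LetIn\<close> binds index 0; the last argument
  of \<open>CaseList\<close> (the branch for a cell) has the first component at index 0 and the second one
  at index 1; the body of a function has its arguments at 0, 1, 2, \<open>\<dots>\<close>.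
  \<open>Call f es\<close> refers to the function in position \<open>f\<close> of the program.
\<close>

datatype expr =
    Var nat
  | Zero
  | One
  | Add expr expr
  | Sub expr expr
  | Mul expr expr
  | Div expr expr
  | Nil0
  | Cell expr expr
  | LetIn expr expr
  | IfLess expr expr expr expr
  | CaseList expr expr expr
  | Call nat "expr list"

type_synonym program = "expr list"

text \<open>
  \<open>eval P env e v T\<close>: under program \<open>P\<close> and environment \<open>env\<close>, the evaluation of \<open>e\<close> stops with
  value \<open>v\<close> after exactly \<open>T\<close> steps. Nontermination, ill-typed operations, division by zero,
  unbound variables and undefined functions have no derivation.
\<close>

inductive eval :: "program \<Rightarrow> val list \<Rightarrow> expr \<Rightarrow> val \<Rightarrow> nat \<Rightarrow> bool"
  and evals :: "program \<Rightarrow> val list \<Rightarrow> expr list \<Rightarrow> val list \<Rightarrow> nat \<Rightarrow> bool"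
  for P :: program
where
  Var: "i < length env \<Longrightarrow> eval P env (Var i) (env ! i) 1"
| Zero: "eval P env Zero (VNum 0) 1"
| One: "eval P env One (VNum 1) 1"
| Add: "eval P env a (VNum x) T1 \<Longrightarrow> eval P env b (VNum y) T2 \<Longrightarrow>
    eval P env (Add a b) (VNum (x + y)) (T1 + T2 + 1)"
| Sub: "eval P env a (VNum x) T1 \<Longrightarrow> eval P env b (VNum y) T2 \<Longrightarrow>
    eval P env (Sub a b) (VNum (x - y)) (T1 + T2 + 1)"
| Mul: "eval P env a (VNum x) T1 \<Longrightarrow> eval P env b (VNum y) T2 \<Longrightarrow>
    eval P env (Mul a b) (VNum (x * y)) (T1 + T2 + 1)"
| Div: "eval P env a (VNum x) T1 \<Longrightarrow> eval P env b (VNum y) T2 \<Longrightarrow> y \<noteq> 0 \<Longrightarrow>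
    eval P env (Div a b) (VNum (x / y)) (T1 + T2 + 1)"
| Nil0: "eval P env Nil0 VNil 1"
| Cell: "eval P env a u T1 \<Longrightarrow> eval P env b v T2 \<Longrightarrow>
    eval P env (Cell a b) (VCons u v) (T1 + T2 + 1)"
| LetIn: "eval P env a u T1 \<Longrightarrow> eval P (u # env) b v T2 \<Longrightarrow>
    eval P env (LetIn a b) v (T1 + T2 + 1)"
| IfLess_True: "eval P env a (VNum x) T1 \<Longrightarrow> eval P env b (VNum y) T2 \<Longrightarrow> x < y \<Longrightarrow>
    eval P env c v T3 \<Longrightarrow> eval P env (IfLess a b c d) v (T1 + T2 + T3 + 1)"
| IfLess_False: "eval P env a (VNum x) T1 \<Longrightarrow> eval P env b (VNum y) T2 \<Longrightarrow> \<not> x < y \<Longrightarrow>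
    eval P env d v T3 \<Longrightarrow> eval P env (IfLess a b c d) v (T1 + T2 + T3 + 1)"
| CaseList_Nil: "eval P env a VNil T1 \<Longrightarrow> eval P env b v T2 \<Longrightarrow>
    eval P env (CaseList a b c) v (T1 + T2 + 1)"
| CaseList_Cons: "eval P env a (VCons x y) T1 \<Longrightarrow> eval P (x # y # env) c v T2 \<Longrightarrow>
    eval P env (CaseList a b c) v (T1 + T2 + 1)"
| Call: "f < length P \<Longrightarrow> evals P env es vs T1 \<Longrightarrow> eval P vs (P ! f) v T2 \<Longrightarrow>
    eval P env (Call f es) v (T1 + T2 + 1)"
| evals_Nil: "evals P env [] [] 0"
| evals_Cons: "eval P env e v T1 \<Longrightarrow> evals P env es vs T2 \<Longrightarrow>
    evals P env (e # es) (v # vs) (T1 + T2)"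

lemma eval_deterministic:
  "eval P env e v T \<Longrightarrow> eval P env e v' T' \<Longrightarrow> v' = v \<and> T' = T"
  "evals P env es vs T \<Longrightarrow> evals P env es vs' T' \<Longrightarrow> vs' = vs \<and> T' = T"
proof (induction arbitrary: v' T' and vs' T' rule: eval_evals.inducts)
  case (Var i env) from Var.prems show ?case by cases auto
next
  case (Zero env) from Zero.prems show ?case by cases auto
next
  case (One env) from One.prems show ?case by cases auto
next
  case Add from Add.prems show ?case by cases (auto dest!: Add.IH(2,4))
next
  case Sub from Sub.prems show ?case by cases (auto dest!: Sub.IH(2,4))
next
  case Mul from Mul.prems show ?case by cases (auto dest!: Mul.IH(2,4))
next
  case Div from Div.prems show ?case by cases (auto dest!: Div.IH(2,4))
next
  case Nil0 from Nil0.prems show ?case by cases auto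
next
  case Cell from Cell.prems show ?case by cases (auto dest!: Cell.IH(2,4))
next
  case LetIn from LetIn.prems show ?case by cases (auto dest!: LetIn.IH(2,4))
next
  case IfLess_True from IfLess_True.prems show ?case by cases (use IfLess_True.hyps in \<open>auto dest!: IfLess_True.IH(2,4,6)\<close>)
next
  case IfLess_False from IfLess_False.prems show ?case by cases (use IfLess_False.hyps in \<open>auto dest!: IfLess_False.IH(2,4,6)\<close>)
next
  case CaseList_Nil from CaseList_Nil.prems show ?case by cases (auto dest!: CaseList_Nil.IH(2,4))
next
  case CaseList_Cons from CaseList_Cons.prems show ?case by cases (auto dest!: CaseList_Cons.IH(2,4))
next
  case Call from Call.prems show ?case by cases (auto dest!: Call.IH(3,5))
next
  case evals_Nil from evals_Nil.prems show ?case by cases auto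
next
  case evals_Cons from evals_Cons.prems show ?case by cases (auto dest!: evals_Cons.IH(2,4))
qed

text \<open>The main function of a program is the one in position 0.\<close>

definition runs :: "program \<Rightarrow> val list \<Rightarrow> val \<Rightarrow> nat \<Rightarrow> bool" where
  "runs P inputs v T \<longleftrightarrow> 0 < length P \<and> eval P inputs (P ! 0) v T"

section \<open>Resource-constrained shortest paths\<close>

text \<open>Resources are numbered \<open>0, \<dots>, m - 1\<close>; \<open>weight I i\<close> is \<open>w\<^sub>i\<close> and \<open>budget I i\<close> is \<open>L\<^sub>i\<close>.\<close>

record rcsp =
  graph :: "nat pair_pre_digraph"
  edge_cost :: "nat \<times> nat \<Rightarrow> real"
  source :: nat
  target :: nat
  resources :: nat
  budget :: "nat \<Rightarrow> real"
  weight :: "nat \<Rightarrow> nat \<times> nat \<Rightarrow> real"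

abbreviation num_verts :: "rcsp \<Rightarrow> nat" where
  "num_verts I \<equiv> card (pverts (graph I))"

definition rcsp_instance :: "rcsp \<Rightarrow> bool" where
  "rcsp_instance I \<longleftrightarrow>
     pair_fin_digraph (graph I) \<and>
     pverts (graph I) = {..<num_verts I} \<and>
     source I \<in> pverts (graph I) \<and> target I \<in> pverts (graph I) \<and>
     (\<forall>e\<in>parcs (graph I). 0 \<le> edge_cost I e) \<and>
     1 \<le> resources I \<and>
     (\<forall>i<resources I. budget I i \<noteq> 0) \<and>
     (\<forall>i<resources I. \<forall>p. pre_digraph.cycle (with_proj (graph I)) p \<longrightarrow>
        0 \<le> (\<Sum>e\<leftarrow>p. weight I i e))"

text \<open>A path is a list of arcs that visits no vertex twice; it is empty if source and target agree.\<close>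

definition st_path :: "rcsp \<Rightarrow> (nat \<times> nat) list \<Rightarrow> bool" where
  "st_path I p \<longleftrightarrow> pre_digraph.apath (with_proj (graph I)) (source I) p (target I)"

definition path_cost :: "rcsp \<Rightarrow> (nat \<times> nat) list \<Rightarrow> real" where
  "path_cost I p = (\<Sum>e\<leftarrow>p. edge_cost I e)"

definition path_weight :: "rcsp \<Rightarrow> nat \<Rightarrow> (nat \<times> nat) list \<Rightarrow> real" where
  "path_weight I i p = (\<Sum>e\<leftarrow>p. weight I i e)"

definition feasible :: "rcsp \<Rightarrow> (nat \<times> nat) list \<Rightarrow> bool" where
  "feasible I p \<longleftrightarrow> st_path I p \<and> (\<forall>i<resources I. path_weight I i p \<le> budget I i)"

lemma finite_feasible:
  assumes "rcsp_instance I"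
  shows "finite {p. feasible I p}"
proof -
  interpret pair_fin_digraph "graph I" using assms by (simp add: rcsp_instance_def)
  show ?thesis
    by (rule finite_subset[OF _ apaths_finite[of "source I" "target I"]])
       (auto simp: feasible_def st_path_def)
qed

text \<open>Only meaningful if a feasible path exists.\<close>

definition rcsp_opt :: "rcsp \<Rightarrow> real" where
  "rcsp_opt I = Min (path_cost I ` {p. feasible I p})"

text \<open>
  Inserting 0 before taking the minimum gives \<open>min {min\<^sub>e w\<^sub>i(e), 0}\<close>, with the value 0 also for a
  graph without edges.
\<close>

definition cond_number :: "rcsp \<Rightarrow> nat \<Rightarrow> real" where
  "cond_number I i = \<bar>Min (insert 0 (weight I i ` parcs (graph I)))\<bar> / \<bar>budget I i\<bar>"

definition tolerances :: "rcsp \<Rightarrow> (nat \<Rightarrow> real) \<Rightarrow> bool" where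
  "tolerances I \<epsilon> \<longleftrightarrow> (\<forall>i<resources I. 0 < budget I i * \<epsilon> i)"

definition approx_solution :: "rcsp \<Rightarrow> (nat \<Rightarrow> real) \<Rightarrow> (nat \<times> nat) list \<Rightarrow> bool" where
  "approx_solution I \<epsilon> p \<longleftrightarrow> st_path I p \<and> path_cost I p \<le> rcsp_opt I \<and>
     (\<forall>i<resources I. path_weight I i p \<le> (1 + \<epsilon> i) * budget I i)"

section \<open>Algorithms for resource-constrained shortest paths\<close>

fun enc_list :: "val list \<Rightarrow> val" where
  "enc_list [] = VNil"
| "enc_list (v # vs) = VCons v (enc_list vs)"

definition enc_path :: "(nat \<times> nat) list \<Rightarrow> val" where
  "enc_path p = enc_list (map (\<lambda>(u, v). VCons (VNum (real u)) (VNum (real v))) p)"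

definition enc_edge :: "rcsp \<Rightarrow> nat \<times> nat \<Rightarrow> val" where
  "enc_edge I e = enc_list
     [VNum (real (fst e)), VNum (real (snd e)), VNum (edge_cost I e),
      enc_list (map (\<lambda>i. VNum (weight I i e)) [0..<resources I])]"

text \<open>The list \<open>es\<close> enumerates the edges in an arbitrary order.\<close>

definition enc_input :: "rcsp \<Rightarrow> (nat \<times> nat) list \<Rightarrow> (nat \<Rightarrow> real) \<Rightarrow> val list" where
  "enc_input I es \<epsilon> =
     [VNum (real (num_verts I)), VNum (real (resources I)),
      VNum (real (source I)), VNum (real (target I)),
      enc_list (map (enc_edge I) es),
      enc_list (map (\<lambda>i. VNum (budget I i)) [0..<resources I]),
      enc_list (map (\<lambda>i. VNum (\<epsilon> i)) [0..<resources I])]"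

text \<open>
  The program has to stop within the time bound on every instance; its output is unconstrained
  if the instance has no feasible path.
\<close>

definition approximates_within :: "program \<Rightarrow> rcsp \<Rightarrow> (nat \<Rightarrow> real) \<Rightarrow> real \<Rightarrow> bool" where
  "approximates_within P I \<epsilon> bound \<longleftrightarrow>
     (\<forall>es. distinct es \<and> set es = parcs (graph I) \<longrightarrow>
        (\<exists>v T. runs P (enc_input I es \<epsilon>) v T \<and> real T \<le> bound \<and>
           ((\<exists>q. feasible I q) \<longrightarrow> (\<exists>p. v = enc_path p \<and> approx_solution I \<epsilon> p))))"

text \<open>
  A running time \<open>poly(n\<^sup>m, \<gamma>\<^sub>1, \<dots>, \<gamma>\<^sub>m, 1/\<bar>\<epsilon>\<^sub>1\<bar>, \<dots>, 1/\<bar>\<epsilon>\<^sub>m\<bar>)\<close> is one that is bounded by \<open>C * x ^ k\<close>,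
  where \<open>x\<close> is the following polynomial in these quantities and \<open>C\<close> and \<open>k\<close> do not depend on
  the instance, in particular not on \<open>m\<close>. For fixed \<open>m\<close> every polynomial in these quantities
  is dominated by such an expression, because \<open>1 \<le> n\<^sup>m\<close>.
\<close>

definition poly_base :: "rcsp \<Rightarrow> (nat \<Rightarrow> real) \<Rightarrow> real" where
  "poly_base I \<epsilon> = real (num_verts I ^ resources I) *
     (\<Prod>i<resources I. (1 + cond_number I i) * (1 + 1 / \<bar>\<epsilon> i\<bar>))"

end

theory Submission
  imports Defs "HOL-Library.FuncSet"
begin

text \<open>
  The program is a label-setting search in the manner of Dijkstra, run backwards from the target. A
  label is a path to the target with its cost and its exact resource weights. The cheapest one-arc
  extension of a settled label is settled next, unless a settled label with the same start vertex
  and no larger cost has weights exceeding those of the extension by at most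
  \<open>\<eta>\<^sub>i = \<epsilon>\<^sub>i L\<^sub>i / n\<close>. Along an optimal path the loss grows by \<open>\<eta>\<^sub>i\<close> per arc, hence stays below
  \<open>\<epsilon>\<^sub>i L\<^sub>i\<close>. Costs and cycle weights are nonnegative, so an extension that revisits a vertex is
  dominated by one of its own suffixes and all labels are simple paths. Their weights therefore lie
  in an interval of length \<open>O(\<bar>L\<^sub>i\<bar> + \<epsilon>\<^sub>i L\<^sub>i + n \<gamma>\<^sub>i \<bar>L\<^sub>i\<bar>)\<close>, and no two settled labels with the same
  start vertex share a cell of the grid of widths \<open>\<eta>\<^sub>i\<close>, which makes their number polynomial.
\<close>

text \<open>Only weights are trimmed; costs are compared exactly, so a dominating label is never
  more expensive and the cost guarantee carries no error factor. A dominating label may use other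
  vertices than the suffix it stands for, so gluing it to the rest of an optimal path need not give
  a simple path. The correctness proof therefore never glues long pieces: it prepends a single arc,
  and such an extension is a candidate whether or not it is simple. Simplicity of the labels that do
  get settled is a consequence, used for the lower weight bound and for the output. Searching
  backwards suits lists: an extension costs one cell, and every suffix of a label is itself a
  settled label. Two demands shape the bounds. Weights may be negative, so a label above its budget
  may still be completed; labels are cut off only at the relaxed budget plus \<open>n\<close> times
  the size of the least weight. And the final exponent and constant must be independent of
  \<open>m\<close>, so no constant factor per resource may survive; each is paid for by a power of
  \<open>n\<close>, which works for \<open>n \<ge> 2\<close> only and makes \<open>n = 1\<close> a
  separate case.\<close>

section \<open>Evaluation within a number of steps\<close>

text \<open>\<open>eval\<close> counts steps exactly, and the count depends on the branches taken.
  Upper bounds compose by rules of fixed shape, and \<open>within_mono\<close> rounds the sum up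
  once at the end.\<close>

definition eval_within :: "program \<Rightarrow> val list \<Rightarrow> expr \<Rightarrow> val \<Rightarrow> nat \<Rightarrow> bool" where
  "eval_within P env e v B \<longleftrightarrow> (\<exists>T\<le>B. eval P env e v T)"

definition evals_within :: "program \<Rightarrow> val list \<Rightarrow> expr list \<Rightarrow> val list \<Rightarrow> nat \<Rightarrow> bool" where
  "evals_within P env es vs B \<longleftrightarrow> (\<exists>T\<le>B. evals P env es vs T)"

text \<open>The branch \<open>Nil0\<close> is a dummy value; the rules below cover nonempty cells
  only.\<close>

definition Head :: "expr \<Rightarrow> expr" where "Head e = CaseList e Nil0 (Var 0)"
definition Tail :: "expr \<Rightarrow> expr" where "Tail e = CaseList e Nil0 (Var 1)"

abbreviation val_of_bool :: "bool \<Rightarrow> val" where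
  "val_of_bool b \<equiv> VNum (if b then 1 else 0)"

lemma within_mono: "eval_within P env e v A \<Longrightarrow> A \<le> B \<Longrightarrow> eval_within P env e v B"
  unfolding eval_within_def by (meson le_trans)

lemma evals_mono: "evals_within P env es vs A \<Longrightarrow> A \<le> B \<Longrightarrow> evals_within P env es vs B"
  unfolding evals_within_def by (meson le_trans)

lemma within_Var: "i < length env \<Longrightarrow> env ! i = v \<Longrightarrow> eval_within P env (Var i) v 1"
  unfolding eval_within_def using eval_evals.Var by blast

lemma within_Zero: "eval_within P env Zero (VNum 0) 1"
  and within_One: "eval_within P env One (VNum 1) 1"
  and within_Nil0: "eval_within P env Nil0 VNil 1"
  unfolding eval_within_def using eval_evals.Zero eval_evals.One eval_evals.Nil0 by blast+

lemma within_arith: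
  assumes "eval_within P env a (VNum x) A" "eval_within P env b (VNum y) B"
  shows within_Add: "eval_within P env (Add a b) (VNum (x + y)) (A + B + 1)"
    and within_Sub: "eval_within P env (Sub a b) (VNum (x - y)) (A + B + 1)"
    and within_Mul: "eval_within P env (Mul a b) (VNum (x * y)) (A + B + 1)"
    and within_Div: "y \<noteq> 0 \<Longrightarrow> eval_within P env (Div a b) (VNum (x / y)) (A + B + 1)"
proof -
  obtain S T where *: "S \<le> A" "T \<le> B" "eval P env a (VNum x) S" "eval P env b (VNum y) T"
    using assms unfolding eval_within_def by blast
  then have le: "S + T + 1 \<le> A + B + 1" by simp
  show "eval_within P env (Add a b) (VNum (x + y)) (A + B + 1)"
    unfolding eval_within_def using le eval_evals.Add[OF *(3,4)] by blast
  show "eval_within P env (Sub a b) (VNum (x - y)) (A + B + 1)"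
    unfolding eval_within_def using le eval_evals.Sub[OF *(3,4)] by blast
  show "eval_within P env (Mul a b) (VNum (x * y)) (A + B + 1)"
    unfolding eval_within_def using le eval_evals.Mul[OF *(3,4)] by blast
  show "eval_within P env (Div a b) (VNum (x / y)) (A + B + 1)" if "y \<noteq> 0"
    unfolding eval_within_def using le eval_evals.Div[OF *(3,4) that] by blast
qed

lemma within_Cell:
  assumes "eval_within P env a u A" "eval_within P env b v B"
  shows "eval_within P env (Cell a b) (VCons u v) (A + B + 1)"
proof -
  obtain S T where *: "S \<le> A" "T \<le> B" "eval P env a u S" "eval P env b v T"
    using assms unfolding eval_within_def by blast
  then have "S + T + 1 \<le> A + B + 1" by simp
  then show ?thesis unfolding eval_within_def using eval_evals.Cell[OF *(3,4)] by blast
qed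

lemma within_LetIn:
  assumes "eval_within P env a u A" "eval_within P (u # env) b v B"
  shows "eval_within P env (LetIn a b) v (A + B + 1)"
proof -
  obtain S T where *: "S \<le> A" "T \<le> B" "eval P env a u S" "eval P (u # env) b v T"
    using assms unfolding eval_within_def by blast
  then have "S + T + 1 \<le> A + B + 1" by simp
  then show ?thesis unfolding eval_within_def using eval_evals.LetIn[OF *(3,4)] by blast
qed

lemma within_IfLess:
  assumes "eval_within P env a (VNum x) A" "eval_within P env b (VNum y) B"
    "x < y \<Longrightarrow> eval_within P env c v C" "\<not> x < y \<Longrightarrow> eval_within P env d v D"
  shows "eval_within P env (IfLess a b c d) v (A + B + max C D + 1)"
proof -
  obtain S T where *: "S \<le> A" "T \<le> B" "eval P env a (VNum x) S" "eval P env b (VNum y) T"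
    using assms unfolding eval_within_def by blast
  show ?thesis
  proof (cases "x < y")
    case True
    then obtain R where "R \<le> C" "eval P env c v R" using assms unfolding eval_within_def by blast
    moreover from this * have "S + T + R + 1 \<le> A + B + max C D + 1" by simp
    ultimately show ?thesis
      unfolding eval_within_def using eval_evals.IfLess_True[OF *(3,4) True] by blast
  next
    case False
    then obtain R where "R \<le> D" "eval P env d v R" using assms unfolding eval_within_def by blast
    moreover from this * have "S + T + R + 1 \<le> A + B + max C D + 1" by simp
    ultimately show ?thesis
      unfolding eval_within_def using eval_evals.IfLess_False[OF *(3,4) False] by blast
  qed
qed

text \<open>The machine has no booleans. Tests return 0 or 1 and are consumed by comparing 0 with
  the result.\<close>

lemma within_If:
  assumes "eval_within P env a (val_of_bool q) A"
    "q \<Longrightarrow> eval_within P env c v C" "\<not> q \<Longrightarrow> eval_within P env d v D"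
  shows "eval_within P env (IfLess Zero a c d) v (A + max C D + 2)"
  using within_IfLess[OF within_Zero assms(1), of c v C d D] assms(2,3)
  by (cases q) (auto simp: add.commute)

lemma within_CaseList_Nil:
  assumes "eval_within P env a VNil A" "eval_within P env b v B"
  shows "eval_within P env (CaseList a b c) v (A + B + 1)"
proof -
  obtain S T where *: "S \<le> A" "T \<le> B" "eval P env a VNil S" "eval P env b v T"
    using assms unfolding eval_within_def by blast
  then have "S + T + 1 \<le> A + B + 1" by simp
  then show ?thesis unfolding eval_within_def using eval_evals.CaseList_Nil[OF *(3,4)] by blast
qed

lemma within_CaseList_Cons:
  assumes "eval_within P env a (VCons x y) A" "eval_within P (x # y # env) c v B"
  shows "eval_within P env (CaseList a b c) v (A + B + 1)"
proof -
  obtain S T where *: "S \<le> A" "T \<le> B" "eval P env a (VCons x y) S" "eval P (x # y # env) c v T"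
    using assms unfolding eval_within_def by blast
  then have "S + T + 1 \<le> A + B + 1" by simp
  then show ?thesis unfolding eval_within_def using eval_evals.CaseList_Cons[OF *(3,4)] by blast
qed

lemma within_Head: "eval_within P env e (VCons x y) A \<Longrightarrow> eval_within P env (Head e) x (A + 2)"
  unfolding Head_def using within_CaseList_Cons[OF _ within_Var, of P env e x y A 0 x]
  by (simp add: numeral_2_eq_2)

lemma within_Tail: "eval_within P env e (VCons x y) A \<Longrightarrow> eval_within P env (Tail e) y (A + 2)"
  unfolding Tail_def using within_CaseList_Cons[OF _ within_Var, of P env e x y A 1 y]
  by (simp add: numeral_2_eq_2)

lemma within_args_Nil: "evals_within P env [] [] 0"
  unfolding evals_within_def using eval_evals.evals_Nil by blast

lemma within_args_Cons:
  assumes "eval_within P env e v A" "evals_within P env es vs B"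
  shows "evals_within P env (e # es) (v # vs) (A + B)"
proof -
  obtain S T where *: "S \<le> A" "T \<le> B" "eval P env e v S" "evals P env es vs T"
    using assms unfolding eval_within_def evals_within_def by blast
  then have "S + T \<le> A + B" by simp
  then show ?thesis unfolding evals_within_def using eval_evals.evals_Cons[OF *(3,4)] by blast
qed

lemma within_Call:
  assumes "evals_within P env es vs A" "f < length P" "eval_within P vs (P ! f) v B"
  shows "eval_within P env (Call f es) v (A + B + 1)"
proof -
  obtain S T where *: "S \<le> A" "T \<le> B" "evals P env es vs S" "eval P vs (P ! f) v T"
    using assms unfolding eval_within_def evals_within_def by blast
  then have "S + T + 1 \<le> A + B + 1" by simp
  then show ?thesis
    unfolding eval_within_def using eval_evals.Call[OF assms(2) *(3,4)] by blast
qed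

lemmas within_intros = within_Zero within_One within_Nil0 within_arith within_Cell within_LetIn
  within_Head within_Tail within_args_Nil within_args_Cons within_Call

section \<open>The program\<close>

text \<open>Arguments: a scalar \<open>a\<close> and two vectors. This one routine provides sums
  (\<open>a = 1\<close>), the zero vector (\<open>a = -1\<close> on two equal vectors), the trimming
  widths (\<open>a = 1 / n\<close>) and the limits (\<open>a = -n\<close>).\<close>

definition axpy_body :: expr where
  "axpy_body = CaseList (Var 1) Nil0 (CaseList (Var 4) Nil0
     (Cell (Add (Mul (Var 4) (Var 2)) (Var 0)) (Call 1 [Var 4, Var 3, Var 1])))"

definition mul_body :: expr where
  "mul_body = CaseList (Var 0) Nil0 (CaseList (Var 3) Nil0
     (Cell (Mul (Var 2) (Var 0)) (Call 2 [Var 3, Var 1])))"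

definition min_body :: expr where
  "min_body = CaseList (Var 0) Nil0 (CaseList (Var 3) Nil0
     (Cell (IfLess (Var 2) (Var 0) (Var 2) (Var 0)) (Call 3 [Var 3, Var 1])))"

definition colmin_body :: expr where
  "colmin_body = CaseList (Var 0) (Var 1)
     (Call 4 [Var 1, Call 3 [Var 3, Head (Tail (Tail (Tail (Var 0))))]])"

definition leq_body :: expr where
  "leq_body = CaseList (Var 0) One (CaseList (Var 3) One
     (IfLess (Var 0) (Var 2) Zero (Call 5 [Var 3, Var 1])))"

text \<open>Arguments: the settled labels, and cost and (already relaxed) vector of a candidate.\<close>

definition dom_body :: expr where
  "dom_body = CaseList (Var 0) Zero
     (IfLess (Var 3) (Head (Var 0)) (Call 6 [Var 1, Var 3, Var 4])
       (IfLess Zero (Call 5 [Head (Tail (Var 0)), Var 4]) One (Call 6 [Var 1, Var 3, Var 4])))"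

text \<open>Arguments: settled labels, trimming widths, limits, the best candidate so far, and cost, vector
  and path of a new candidate.\<close>

definition improve_body :: expr where
  "improve_body = IfLess Zero (Call 5 [Var 5, Var 2])
     (IfLess Zero (Call 6 [Var 0, Var 4, Call 1 [One, Var 1, Var 5]]) (Var 3)
       (CaseList (Var 3) (Cell (Var 4) (Cell (Var 5) (Var 6)))
         (IfLess (Var 6) (Var 0) (Cell (Var 6) (Cell (Var 7) (Var 8))) (Var 5))))
     (Var 3)"

text \<open>Arguments: remaining arcs, settled labels, widths, limits, best candidate, and cost,
  vector and path of the label to extend. The \<open>let\<close> abbreviates machine expressions at
  the level of HOL, so the fields of the arc are fetched again at each use, at constant cost. Adding
  \<open>u - v\<close> and \<open>v - u\<close> to the two leading entries moves the start vertex
  from \<open>v\<close> to \<open>u\<close>.\<close>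

definition scan_edges_body :: expr where
  "scan_edges_body = (let u = Head (Var 0); v = Head (Tail (Var 0));
       c = Head (Tail (Tail (Var 0))); w = Head (Tail (Tail (Tail (Var 0)))) in
     CaseList (Var 0) (Var 4) (Call 8 [Var 1, Var 3, Var 4, Var 5,
       IfLess Zero (Call 5 [Var 8, Cell v (Cell (Sub Zero v) Nil0)])
         (Call 7 [Var 3, Var 4, Var 5, Var 6, Add (Var 7) c,
           Call 1 [One, Cell (Sub u v) (Cell (Sub v u) w), Var 8], Cell (Cell u v) (Var 9)])
         (Var 6),
       Var 7, Var 8, Var 9]))"

text \<open>The settled labels are passed twice: the first copy is consumed label by label, the
  second stays whole for the domination tests.\<close>

definition scan_labels_body :: expr where
  "scan_labels_body = CaseList (Var 0) (Var 5) (Call 9 [Var 1, Var 3, Var 4, Var 5, Var 6,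
     Call 8 [Var 4, Var 3, Var 5, Var 6, Var 7,
       Head (Var 0), Head (Tail (Var 0)), Tail (Tail (Var 0))]])"

text \<open>Each round rescans all pairs of a settled label and an arc, which a polynomial bound can
  afford. The value \<open>VNil\<close> for the best candidate ends the recursion; an encoded label
  is always a cell.\<close>

definition settle_body :: expr where
  "settle_body = LetIn (Call 9 [Var 0, Var 0, Var 1, Var 2, Var 3, Nil0])
     (CaseList (Var 0) (Var 1) (Call 10 [Cell (Var 2) (Var 3), Var 4, Var 5, Var 6]))"

definition select_body :: expr where
  "select_body = CaseList (Var 0) (Var 2) (Call 11 [Var 1, Var 3,
     IfLess Zero (Call 5 [Head (Tail (Var 0)), Var 3]) (Tail (Tail (Var 0))) (Var 4)])"

text \<open>Arguments: \<open>n\<close>, \<open>m\<close>, \<open>s\<close>, \<open>t\<close>, edges, budgets, tolerances. The nested bindings are the slacks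
  \<open>\<epsilon>\<^sub>i L\<^sub>i\<close>, the zero vector (as \<open>L - L\<close>), the relaxed budgets \<open>(1 + \<epsilon>\<^sub>i) L\<^sub>i\<close> and the settled labels.
  For \<open>n = 1\<close> the time bound does not grow with \<open>m\<close>, so the program must not read the vectors.\<close>

definition main_body :: expr where
  "main_body = IfLess One (Var 0)
     (LetIn (Call 2 [Var 5, Var 6])
     (LetIn (Call 1 [Sub Zero One, Var 6, Var 6])
     (LetIn (Call 1 [One, Var 1, Var 7])
     (LetIn (Call 10
        [Cell (Cell Zero (Cell (Cell (Var 6) (Cell (Sub Zero (Var 6)) (Var 1))) Nil0)) Nil0,
         Var 7,
         Cell Zero (Cell Zero (Call 1 [Div One (Var 3), Var 2, Var 1])),
         Cell (Var 3) (Cell Zero (Call 1 [Sub Zero (Var 3), Call 4 [Var 7, Var 1], Var 0]))])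
     (Call 11 [Var 0, Cell (Var 6) (Cell (Sub Zero (Var 6)) (Var 1)), Nil0])))))
     Nil0"

definition rcsp_program :: program where
  "rcsp_program = [main_body, axpy_body, mul_body, min_body, colmin_body, leq_body, dom_body,
     improve_body, scan_edges_body, scan_labels_body, settle_body, select_body]"

lemma rcsp_program_nth:
  "length rcsp_program = 12"
  "rcsp_program ! 0 = main_body" "rcsp_program ! Suc 0 = axpy_body" "rcsp_program ! 2 = mul_body"
  "rcsp_program ! 3 = min_body" "rcsp_program ! 4 = colmin_body" "rcsp_program ! 5 = leq_body"
  "rcsp_program ! 6 = dom_body" "rcsp_program ! 7 = improve_body"
  "rcsp_program ! 8 = scan_edges_body" "rcsp_program ! 9 = scan_labels_body"
  "rcsp_program ! 10 = settle_body" "rcsp_program ! 11 = select_body"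
  by (simp_all add: rcsp_program_def)

abbreviation returns :: "val list \<Rightarrow> nat \<Rightarrow> val \<Rightarrow> nat \<Rightarrow> bool" where
  "returns vs f v B \<equiv> eval_within rcsp_program vs (rcsp_program ! f) v B"

section \<open>Vector arithmetic and comparison on encoded lists of reals\<close>

definition enc_nums :: "real list \<Rightarrow> val" where
  "enc_nums xs = enc_list (map VNum xs)"

lemma enc_nums_simps [simp]:
  "enc_nums [] = VNil" "enc_nums (x # xs) = VCons (VNum x) (enc_nums xs)"
  by (simp_all add: enc_nums_def)

definition axpy :: "real \<Rightarrow> real list \<Rightarrow> real list \<Rightarrow> real list" where
  "axpy a = map2 (\<lambda>x y. a * x + y)"

text \<open>\<^const>\<open>zip\<close> truncates, which is exploited below: comparing a label vector with \<open>[v, -v]\<close> only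
  tests its start vertex.\<close>

definition leqs :: "real list \<Rightarrow> real list \<Rightarrow> bool" where
  "leqs xs ys \<longleftrightarrow> (\<forall>(x, y)\<in>set (zip xs ys). x \<le> y)"

lemma axpy_simps [simp]:
  "axpy a [] ys = []" "axpy a xs [] = []" "axpy a (x # xs) (y # ys) = (a * x + y) # axpy a xs ys"
  by (simp_all add: axpy_def)

lemma length_axpy [simp]: "length (axpy a xs ys) = min (length xs) (length ys)"
  by (simp add: axpy_def)

lemma leqs_simps [simp]:
  "leqs [] ys" "leqs xs []" "leqs (x # xs) (y # ys) \<longleftrightarrow> x \<le> y \<and> leqs xs ys"
  by (simp_all add: leqs_def)

lemma within_Cell_nums:
  "eval_within P env a (VNum x) A \<Longrightarrow> eval_within P env b (enc_nums xs) B \<Longrightarrow>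
    eval_within P env (Cell a b) (enc_nums (x # xs)) (A + B + 1)"
  using within_Cell by simp

lemma within_Nil_nums: "eval_within P env Nil0 (enc_nums []) 1"
  using within_Nil0 by simp

text \<open>The constant 20 per entry is generous. What matters is that the bound is linear in the
  first vector alone, since the recursion stops at the end of the shorter one.\<close>

lemma returns_axpy:
  "returns [VNum a, enc_nums xs, enc_nums ys] 1 (enc_nums (axpy a xs ys)) (20 * (length xs + 1))"
proof (induction xs arbitrary: ys)
  case Nil
  show ?case
    unfolding rcsp_program_nth One_nat_def axpy_body_def
    by (rule within_mono, rule within_CaseList_Nil, rule within_Var) (auto intro: within_Nil0)
next
  case (Cons x xs)
  show ?case
  proof (cases ys)
    case [simp]: Nil
    show ?thesis
      unfolding rcsp_program_nth One_nat_def axpy_body_def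
      by (rule within_mono, rule within_CaseList_Cons, rule within_Var, simp, simp,
          rule within_CaseList_Nil, rule within_Var) (auto intro: within_Nil0)
  next
    case [simp]: (Cons y zs)
    show ?thesis
      unfolding rcsp_program_nth One_nat_def axpy_body_def
      apply (rule within_mono)
       apply (rule within_CaseList_Cons, rule within_Var, simp, simp)+
       apply simp
       apply (rule within_intros within_Var Cons.IH[unfolded One_nat_def] | simp add: rcsp_program_nth; fail)+
      done
  qed
qed

lemma within_axpy:
  assumes "eval_within rcsp_program env a (VNum c) A" "eval_within rcsp_program env x (enc_nums xs) B"
    "eval_within rcsp_program env y (enc_nums ys) C"
  shows "eval_within rcsp_program env (Call 1 [a, x, y]) (enc_nums (axpy c xs ys))
    (A + B + C + 20 * (length xs + 1) + 1)"
  using within_Call[OF within_args_Cons[OF assms(1) within_args_Cons[OF assms(2)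
      within_args_Cons[OF assms(3) within_args_Nil]]] _ returns_axpy]
  by (simp add: rcsp_program_nth ac_simps)

lemma returns_mul:
  "returns [enc_nums xs, enc_nums ys] 2 (enc_nums (map2 (*) xs ys)) (20 * (length xs + 1))"
proof (induction xs arbitrary: ys)
  case Nil
  show ?case
    unfolding rcsp_program_nth mul_body_def
    by (rule within_mono, rule within_CaseList_Nil, rule within_Var) (auto intro: within_Nil0)
next
  case (Cons x xs)
  show ?case
  proof (cases ys)
    case [simp]: Nil
    show ?thesis
      unfolding rcsp_program_nth mul_body_def
      by (rule within_mono, rule within_CaseList_Cons, rule within_Var, simp, simp,
          rule within_CaseList_Nil, rule within_Var) (auto intro: within_Nil0)
  next
    case [simp]: (Cons y zs)
    show ?thesis
      unfolding rcsp_program_nth mul_body_def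
      apply (rule within_mono)
       apply (rule within_CaseList_Cons, rule within_Var, simp, simp)+
       apply simp
       apply (rule within_intros within_Var Cons.IH | simp add: rcsp_program_nth; fail)+
      done
  qed
qed

lemma within_mul:
  assumes "eval_within rcsp_program env x (enc_nums xs) B"
    "eval_within rcsp_program env y (enc_nums ys) C"
  shows "eval_within rcsp_program env (Call 2 [x, y]) (enc_nums (map2 (*) xs ys))
    (B + C + 20 * (length xs + 1) + 1)"
  using within_Call[OF within_args_Cons[OF assms(1) within_args_Cons[OF assms(2)
      within_args_Nil]] _ returns_mul]
  by (simp add: rcsp_program_nth ac_simps)

lemma returns_min:
  "returns [enc_nums xs, enc_nums ys] 3 (enc_nums (map2 min xs ys)) (20 * (length xs + 1))"
proof (induction xs arbitrary: ys)
  case Nil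
  show ?case
    unfolding rcsp_program_nth min_body_def
    by (rule within_mono, rule within_CaseList_Nil, rule within_Var) (auto intro: within_Nil0)
next
  case (Cons x xs)
  show ?case
  proof (cases ys)
    case [simp]: Nil
    show ?thesis
      unfolding rcsp_program_nth min_body_def
      by (rule within_mono, rule within_CaseList_Cons, rule within_Var, simp, simp,
          rule within_CaseList_Nil, rule within_Var) (auto intro: within_Nil0)
  next
    case [simp]: (Cons y zs)
    show ?thesis
      unfolding rcsp_program_nth min_body_def
      apply (rule within_mono)
       apply (rule within_CaseList_Cons, rule within_Var, simp, simp)+
       apply simp
       apply (rule within_Cell)
        apply (rule within_IfLess[where x = x and y = y and C = 1 and D = 1])
           apply (rule within_Var; simp; fail)+
       apply (rule within_intros within_Var Cons.IH | simp add: rcsp_program_nth; fail)+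
      done
  qed
qed

lemma returns_leq:
  "returns [enc_nums xs, enc_nums ys] 5 (val_of_bool (leqs xs ys)) (20 * (length xs + 1))"
proof (induction xs arbitrary: ys)
  case Nil
  show ?case
    unfolding rcsp_program_nth leq_body_def
    by (rule within_mono, rule within_CaseList_Nil, rule within_Var) (auto intro: within_One)
next
  case (Cons x xs)
  show ?case
  proof (cases ys)
    case [simp]: Nil
    show ?thesis
      unfolding rcsp_program_nth leq_body_def
      by (rule within_mono, rule within_CaseList_Cons, rule within_Var, simp, simp,
          rule within_CaseList_Nil, rule within_Var) (auto intro: within_One)
  next
    case [simp]: (Cons y zs)
    have rec: "eval_within rcsp_program (VNum y # enc_nums zs # VNum x # enc_nums xs # env)
       (Call 5 [Var 3, Var 1]) (val_of_bool (leqs xs zs)) (20 * (length xs + 1) + 3)" for env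
      by (rule within_mono, (rule within_intros within_Var Cons.IH
            | simp add: rcsp_program_nth; fail)+)
    show ?thesis
      unfolding rcsp_program_nth leq_body_def
      apply (rule within_mono)
       apply (rule within_CaseList_Cons, rule within_Var, simp, simp)+
       apply (rule within_IfLess[where x = y and y = x and C = 1 and D = "20 * (length xs + 1) + 3"])
          apply (rule within_Var; simp; fail)+
      using within_Zero rec by simp_all
  qed
qed

lemma within_leq:
  assumes "eval_within rcsp_program env x (enc_nums xs) B"
    "eval_within rcsp_program env y (enc_nums ys) C"
  shows "eval_within rcsp_program env (Call 5 [x, y]) (val_of_bool (leqs xs ys))
    (B + C + 20 * (length xs + 1) + 1)"
  using within_Call[OF within_args_Cons[OF assms(1) within_args_Cons[OF assms(2)
      within_args_Nil]] _ returns_leq]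
  by (simp add: rcsp_program_nth ac_simps)

section \<open>Labels and their encoding\<close>

text \<open>The search runs backwards from the target, so labels are paths ending there and are extended
  by prepending an arc.\<close>

definition start_vertex :: "rcsp \<Rightarrow> (nat \<times> nat) list \<Rightarrow> nat" where
  "start_vertex I p = (case p of [] \<Rightarrow> target I | e # _ \<Rightarrow> fst e)"

definition edge_weights :: "rcsp \<Rightarrow> nat \<times> nat \<Rightarrow> real list" where
  "edge_weights I e = map (\<lambda>i. weight I i e) [0..<resources I]"

text \<open>The start vertex \<open>v\<close> is stored as the entries \<open>v\<close> and \<open>-v\<close>: a componentwise comparison of label
  vectors then tests equality of vertices along with the inequalities between weights.\<close>

definition label_vec :: "rcsp \<Rightarrow> (nat \<times> nat) list \<Rightarrow> real list" where
  "label_vec I p = real (start_vertex I p) # - real (start_vertex I p) #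
     map (\<lambda>i. path_weight I i p) [0..<resources I]"

text \<open>Cost and vector are stored, so that prepending an arc updates them without walking along
  the path.\<close>

definition enc_label :: "rcsp \<Rightarrow> (nat \<times> nat) list \<Rightarrow> val" where
  "enc_label I p = VCons (VNum (path_cost I p)) (VCons (enc_nums (label_vec I p)) (enc_path p))"

definition enc_labels :: "rcsp \<Rightarrow> (nat \<times> nat) list list \<Rightarrow> val" where
  "enc_labels I S = enc_list (map (enc_label I) S)"

definition enc_edges :: "rcsp \<Rightarrow> (nat \<times> nat) list \<Rightarrow> val" where
  "enc_edges I es = enc_list (map (enc_edge I) es)"

definition enc_best :: "rcsp \<Rightarrow> (nat \<times> nat) list option \<Rightarrow> val" where
  "enc_best I b = (case b of None \<Rightarrow> VNil | Some p \<Rightarrow> enc_label I p)"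

definition dominated :: "rcsp \<Rightarrow> (nat \<times> nat) list list \<Rightarrow> real \<Rightarrow> real list \<Rightarrow> bool" where
  "dominated I S c x \<longleftrightarrow> (\<exists>a\<in>set S. path_cost I a \<le> c \<and> leqs (label_vec I a) x)"

definition admissible ::
    "rcsp \<Rightarrow> real list \<Rightarrow> real list \<Rightarrow> (nat \<times> nat) list list \<Rightarrow> (nat \<times> nat) list \<Rightarrow> bool" where
  "admissible I \<eta> U S q \<longleftrightarrow>
     leqs (label_vec I q) U \<and> \<not> dominated I S (path_cost I q) (axpy 1 \<eta> (label_vec I q))"

definition improve :: "rcsp \<Rightarrow> real list \<Rightarrow> real list \<Rightarrow> (nat \<times> nat) list list \<Rightarrow>
    (nat \<times> nat) list \<Rightarrow> (nat \<times> nat) list option \<Rightarrow> (nat \<times> nat) list option" where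
  "improve I \<eta> U S q b =
     (if admissible I \<eta> U S q \<and> (\<forall>r. b = Some r \<longrightarrow> path_cost I q < path_cost I r)
      then Some q else b)"

definition scan_edges :: "rcsp \<Rightarrow> real list \<Rightarrow> real list \<Rightarrow> (nat \<times> nat) list \<Rightarrow>
    (nat \<times> nat) list list \<Rightarrow> (nat \<times> nat) list \<Rightarrow>
    (nat \<times> nat) list option \<Rightarrow> (nat \<times> nat) list option" where
  "scan_edges I \<eta> U es S p b =
     fold (\<lambda>e b. if start_vertex I p = snd e then improve I \<eta> U S (e # p) b else b) es b"

definition scan_labels :: "rcsp \<Rightarrow> real list \<Rightarrow> real list \<Rightarrow> (nat \<times> nat) list \<Rightarrow>
    (nat \<times> nat) list list \<Rightarrow> (nat \<times> nat) list list \<Rightarrow>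
    (nat \<times> nat) list option \<Rightarrow> (nat \<times> nat) list option" where
  "scan_labels I \<eta> U es S R b = fold (scan_edges I \<eta> U es S) R b"

definition select :: "rcsp \<Rightarrow> real list \<Rightarrow> (nat \<times> nat) list list \<Rightarrow>
    (nat \<times> nat) list \<Rightarrow> (nat \<times> nat) list" where
  "select I g S b = fold (\<lambda>a b. if leqs (label_vec I a) g then a else b) S b"

lemma length_edge_weights [simp]: "length (edge_weights I e) = resources I"
  by (simp add: edge_weights_def)

lemma length_label_vec [simp]: "length (label_vec I p) = resources I + 2"
  by (simp add: label_vec_def)

lemma enc_labels_simps [simp]:
  "enc_labels I [] = VNil" "enc_labels I (p # S) = VCons (enc_label I p) (enc_labels I S)"
  by (simp_all add: enc_labels_def)

lemma enc_edges_simps [simp]: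
  "enc_edges I [] = VNil" "enc_edges I (e # es) = VCons (enc_edge I e) (enc_edges I es)"
  by (simp_all add: enc_edges_def)

lemma enc_path_simps [simp]:
  "enc_path [] = VNil"
  "enc_path (e # p) = VCons (VCons (VNum (real (fst e))) (VNum (real (snd e)))) (enc_path p)"
  by (simp_all add: enc_path_def case_prod_unfold)

lemma enc_edge_eq:
  "enc_edge I e = VCons (VNum (real (fst e))) (VCons (VNum (real (snd e)))
     (VCons (VNum (edge_cost I e)) (VCons (enc_nums (edge_weights I e)) VNil)))"
  by (simp add: enc_edge_def enc_nums_def edge_weights_def comp_def)

lemma path_cost_simps [simp]:
  "path_cost I [] = 0" "path_cost I (e # p) = edge_cost I e + path_cost I p"
  by (simp_all add: path_cost_def)

lemma path_weight_simps [simp]: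
  "path_weight I i [] = 0" "path_weight I i (e # p) = weight I i e + path_weight I i p"
  by (simp_all add: path_weight_def)

lemma start_vertex_simps [simp]:
  "start_vertex I [] = target I" "start_vertex I (e # p) = fst e"
  by (simp_all add: start_vertex_def)

section \<open>Running times of the functions\<close>

lemma within_label:
  assumes "eval_within P env e (enc_label I p) A"
  shows within_label_cost: "eval_within P env (Head e) (VNum (path_cost I p)) (A + 2)"
    and within_label_vec: "eval_within P env (Head (Tail e)) (enc_nums (label_vec I p)) (A + 4)"
    and within_label_path: "eval_within P env (Tail (Tail e)) (enc_path p) (A + 4)"
proof -
  note 1 = assms[unfolded enc_label_def]
  note 2 = within_Tail[OF 1]
  show "eval_within P env (Head e) (VNum (path_cost I p)) (A + 2)"
    "eval_within P env (Head (Tail e)) (enc_nums (label_vec I p)) (A + 4)"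
    "eval_within P env (Tail (Tail e)) (enc_path p) (A + 4)"
    using within_Head[OF 1] within_Head[OF 2] within_Tail[OF 2]
    by (simp_all add: eval_nat_numeral)
qed

lemma within_edge:
  assumes "eval_within P env e (enc_edge I a) A"
  shows within_edge_fst: "eval_within P env (Head e) (VNum (real (fst a))) (A + 2)"
    and within_edge_snd: "eval_within P env (Head (Tail e)) (VNum (real (snd a))) (A + 4)"
    and within_edge_cost:
      "eval_within P env (Head (Tail (Tail e))) (VNum (edge_cost I a)) (A + 6)"
    and within_edge_weights:
      "eval_within P env (Head (Tail (Tail (Tail e)))) (enc_nums (edge_weights I a)) (A + 8)"
proof -
  note 1 = assms[unfolded enc_edge_eq]
  note 2 = within_Tail[OF 1]
  note 3 = within_Tail[OF 2]
  note 4 = within_Tail[OF 3]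
  show "eval_within P env (Head e) (VNum (real (fst a))) (A + 2)"
    "eval_within P env (Head (Tail e)) (VNum (real (snd a))) (A + 4)"
    "eval_within P env (Head (Tail (Tail e))) (VNum (edge_cost I a)) (A + 6)"
    "eval_within P env (Head (Tail (Tail (Tail e)))) (enc_nums (edge_weights I a)) (A + 8)"
    using within_Head[OF 1] within_Head[OF 2] within_Head[OF 3] within_Head[OF 4]
    by (simp_all add: eval_nat_numeral)
qed

definition min_weights :: "rcsp \<Rightarrow> (nat \<times> nat) list \<Rightarrow> real list \<Rightarrow> real list" where
  "min_weights I es x = fold (\<lambda>e y. map2 min y (edge_weights I e)) es x"

lemma length_min_weights: "length x = resources I \<Longrightarrow> length (min_weights I es x) = resources I"
  by (induction es arbitrary: x) (simp_all add: min_weights_def)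

lemma returns_min_weights:
  "length x = resources I \<Longrightarrow> returns [enc_edges I es, enc_nums x] 4 (enc_nums (min_weights I es x))
     (20 * (resources I + 3) * (length es + 1))"
proof (induction es arbitrary: x)
  case Nil
  show ?case
    unfolding rcsp_program_nth colmin_body_def
    apply (rule within_mono, rule within_CaseList_Nil, rule within_Var, simp, simp)
     apply (rule within_Var)
    by (simp_all add: min_weights_def)
next
  case (Cons e es)
  have len: "length (map2 min x (edge_weights I e)) = resources I" using Cons.prems by simp
  have "eval_within rcsp_program [enc_edge I e, enc_edges I es, enc_edges I (e # es), enc_nums x]
     (Call 3 [Var 3, Head (Tail (Tail (Tail (Var 0))))])
      (enc_nums (map2 min x (edge_weights I e))) (20 * (length x + 1) + 11)"
    by (rule within_mono, rule within_Call, rule within_args_Cons, rule within_Var, simp, simp,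
        rule within_args_Cons, rule within_edge_weights, rule within_Var, simp, simp,
        rule within_args_Nil, simp add: rcsp_program_nth, rule returns_min, simp)
  then have args: "evals_within rcsp_program
      [enc_edge I e, enc_edges I es, enc_edges I (e # es), enc_nums x]
      [Var 1, Call 3 [Var 3, Head (Tail (Tail (Tail (Var 0))))]]
      [enc_edges I es, enc_nums (map2 min x (edge_weights I e))]
      (1 + (20 * (length x + 1) + 11 + 0))"
    by (intro within_args_Cons within_args_Nil within_Var) simp_all
  have fold: "min_weights I (e # es) x = min_weights I es (map2 min x (edge_weights I e))"
    by (simp add: min_weights_def)
  show ?case
    unfolding rcsp_program_nth colmin_body_def fold
    apply (rule within_mono, rule within_CaseList_Cons, rule within_Var, simp, simp)
     apply (rule within_Call[OF args _ Cons.IH[OF len, folded rcsp_program_nth(6)]])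
     apply (simp add: rcsp_program_nth)
    using Cons.prems by (simp add: algebra_simps)
qed

text \<open>Per settled label, \<open>20 * (resources I + 3)\<close> pays for comparing vectors of
  length \<open>resources I + 2\<close>, and 40 for the remaining constant work. This factor
  reappears below as \<open>K\<close>.\<close>

lemma returns_dominated:
  "returns [enc_labels I S, VNum c, enc_nums x] 6 (val_of_bool (dominated I S c x))
     ((20 * (resources I + 3) + 40) * (length S + 1))"
proof (induction S)
  case Nil
  show ?case
    unfolding rcsp_program_nth dom_body_def
    by (rule within_mono, rule within_CaseList_Nil, rule within_Var)
      (auto intro: within_Zero simp: dominated_def)
next
  case (Cons a S)
  let ?T = "(20 * (resources I + 3) + 40) * (length S + 1)"
  let ?env = "[enc_label I a, enc_labels I S, enc_labels I (a # S), VNum c, enc_nums x]"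
  have rec: "eval_within rcsp_program ?env
      (Call 6 [Var 1, Var 3, Var 4]) (val_of_bool (dominated I S c x)) (?T + 4)"
    by (rule within_mono, (rule within_intros within_Var Cons.IH
            | simp add: rcsp_program_nth; fail)+)
  have leq: "eval_within rcsp_program ?env (Call 5 [Head (Tail (Var 0)), Var 4])
      (val_of_bool (leqs (label_vec I a) x)) (20 * (resources I + 3) + 7)"
    by (rule within_mono, rule within_leq, rule within_label_vec, rule within_Var, simp, simp,
        rule within_Var) auto
  have *: "dominated I (a # S) c x \<longleftrightarrow>
      \<not> c < path_cost I a \<and> leqs (label_vec I a) x \<or> dominated I S c x"
    by (auto simp: dominated_def)
  have inner: "eval_within rcsp_program ?env
      (IfLess Zero (Call 5 [Head (Tail (Var 0)), Var 4]) One (Call 6 [Var 1, Var 3, Var 4]))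
      (val_of_bool (leqs (label_vec I a) x \<or> dominated I S c x))
      (20 * (resources I + 3) + 7 + (?T + 4) + 2)"
    by (rule within_mono, rule within_If[OF leq, of _ _ 1 _ "?T + 4"])
      (use within_One rec in auto)
  show ?case
    unfolding rcsp_program_nth dom_body_def
    apply (rule within_mono, rule within_CaseList_Cons, rule within_Var, simp, simp)
     apply (rule within_IfLess[where x = c and y = "path_cost I a" and C = "?T + 4"
          and D = "20 * (resources I + 3) + 7 + (?T + 4) + 2"])
        apply (rule within_Var, simp, simp)
       apply (rule within_label_cost, rule within_Var, simp, simp)
    using rec inner by (simp_all add: *)
qed

lemma within_dominated:
  assumes "eval_within rcsp_program env s (enc_labels I S) A" "eval_within rcsp_program env a (VNum c) B"
    "eval_within rcsp_program env b (enc_nums x) C"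
  shows "eval_within rcsp_program env (Call 6 [s, a, b]) (val_of_bool (dominated I S c x))
    (A + B + C + (20 * (resources I + 3) + 40) * (length S + 1) + 1)"
  using within_Call[OF within_args_Cons[OF assms(1) within_args_Cons[OF assms(2)
      within_args_Cons[OF assms(3) within_args_Nil]]] _ returns_dominated]
  by (simp add: rcsp_program_nth ac_simps)

lemma returns_improve:
  assumes len: "length \<eta> = resources I + 2"
  defines "K \<equiv> 20 * (resources I + 3) + 40"
  shows "returns [enc_labels I S, enc_nums \<eta>, enc_nums U, enc_best I b,
      VNum (path_cost I q), enc_nums (label_vec I q), enc_path q] 7
     (enc_best I (improve I \<eta> U S q b)) (K * (length S + 4))"
proof -
  let ?env = "[enc_labels I S, enc_nums \<eta>, enc_nums U, enc_best I b,
      VNum (path_cost I q), enc_nums (label_vec I q), enc_path q]"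
  let ?dom = "dominated I S (path_cost I q) (axpy 1 \<eta> (label_vec I q))"
  have bound: "eval_within rcsp_program ?env (Call 5 [Var 5, Var 2])
      (val_of_bool (leqs (label_vec I q) U)) (K + 3)"
    by (rule within_mono, rule within_leq, rule within_Var, simp, simp, rule within_Var)
      (auto simp: K_def)
  have dom: "eval_within rcsp_program ?env (Call 6 [Var 0, Var 4, Call 1 [One, Var 1, Var 5]])
      (val_of_bool ?dom) (K * (length S + 2))"
    by (rule within_mono, rule within_dominated, rule within_Var, simp, simp, rule within_Var,
        simp, simp, rule within_axpy, rule within_One, rule within_Var, simp, simp,
        rule within_Var) (auto simp: K_def len)
  define better where "better \<longleftrightarrow> (\<forall>r. b = Some r \<longrightarrow> path_cost I q < path_cost I r)"
  have take: "eval_within rcsp_program ?env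
      (CaseList (Var 3) (Cell (Var 4) (Cell (Var 5) (Var 6)))
         (IfLess (Var 6) (Var 0) (Cell (Var 6) (Cell (Var 7) (Var 8))) (Var 5)))
      (enc_best I (if better then Some q else b)) 20"
  proof (cases b)
    case None
    show ?thesis
      apply (rule within_mono, rule within_CaseList_Nil, rule within_Var, simp,
          simp add: None enc_best_def)
       apply (simp add: None better_def enc_best_def enc_label_def)
       apply (rule within_intros within_Var | simp; fail)+
      done
  next
    case (Some r)
    show ?thesis
      apply (rule within_mono, rule within_CaseList_Cons, rule within_Var, simp)
        apply (simp add: Some enc_best_def enc_label_def)
       apply (rule within_IfLess[where x = "path_cost I q" and y = "path_cost I r"
            and C = 5 and D = 1])
          apply (rule within_Var, simp, simp)
         apply (rule within_Var, simp, simp)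
        apply (simp add: Some better_def enc_best_def enc_label_def)
        apply (rule within_mono, (rule within_intros within_Var | simp; fail)+)
       apply (simp add: Some better_def enc_best_def enc_label_def)
       apply simp
      done
  qed
  have inner: "eval_within rcsp_program ?env
     (IfLess Zero (Call 6 [Var 0, Var 4, Call 1 [One, Var 1, Var 5]]) (Var 3)
       (CaseList (Var 3) (Cell (Var 4) (Cell (Var 5) (Var 6)))
         (IfLess (Var 6) (Var 0) (Cell (Var 6) (Cell (Var 7) (Var 8))) (Var 5))))
      (enc_best I (if \<not> ?dom \<and> better then Some q else b)) (K * (length S + 2) + 22)"
    by (rule within_mono, rule within_If[OF dom, of _ _ 1 _ 20])
      (use take in \<open>auto intro: within_Var[unfolded One_nat_def]\<close>)
  show ?thesis
    unfolding rcsp_program_nth improve_body_def improve_def admissible_def better_def[symmetric]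
    apply (rule within_mono, rule within_If[OF bound, of _ _ "K * (length S + 2) + 22" _ 1])
    using inner by (auto intro: within_Var[unfolded One_nat_def] simp: K_def algebra_simps)
qed

lemma leqs_start_vertex:
  "leqs (label_vec I p) [real v, - real v] \<longleftrightarrow> start_vertex I p = v"
  by (auto simp: label_vec_def)

text \<open>The leading entries \<open>v\<close> and \<open>-v\<close> become \<open>u\<close> and
  \<open>-u\<close>, so a single vector addition updates vertex and weights together.\<close>

lemma label_vec_Cons:
  assumes "start_vertex I p = v"
  shows "axpy 1 ((real u - real v) # (real v - real u) # edge_weights I (u, v)) (label_vec I p)
    = label_vec I ((u, v) # p)"
  using assms
  by (simp add: label_vec_def edge_weights_def axpy_def zip_map_map zip_same_conv_map)

lemma returns_scan_edges:
  assumes len: "length \<eta> = resources I + 2"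
  defines "K \<equiv> 20 * (resources I + 3) + 40"
  shows "returns [enc_edges I es, enc_labels I S, enc_nums \<eta>, enc_nums U, enc_best I b,
      VNum (path_cost I p), enc_nums (label_vec I p), enc_path p] 8
     (enc_best I (scan_edges I \<eta> U es S p b)) (K * (length S + 9) * (length es + 1))"
proof (induction es arbitrary: b)
  case Nil
  have "3 \<le> K * (length S + 9)" by (simp add: K_def algebra_simps)
  then show ?case
    unfolding rcsp_program_nth scan_edges_body_def Let_def
    apply (intro within_mono[where A = 3 and B = "K * (length S + 9) * (length [] + 1)"])
     apply (rule within_mono, rule within_CaseList_Nil, rule within_Var, simp, simp)
      apply (rule within_Var)
        apply (simp_all add: scan_edges_def)
    done
next
  case (Cons e es)
  let ?env = "[enc_edge I e, enc_edges I es, enc_edges I (e # es), enc_labels I S, enc_nums \<eta>,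
      enc_nums U, enc_best I b, VNum (path_cost I p), enc_nums (label_vec I p), enc_path p]"
  obtain u v where e: "e = (u, v)" by force
  let ?u = "Head (Var 0)" and ?v = "Head (Tail (Var 0))"
  let ?c = "Head (Tail (Tail (Var 0)))" and ?w = "Head (Tail (Tail (Tail (Var 0))))"
  have edge: "eval_within rcsp_program ?env (Var 0) (enc_edge I e) 1"
    by (rule within_Var) simp_all
  note u = within_edge_fst[OF edge, unfolded e fst_conv]
    and v = within_edge_snd[OF edge, unfolded e snd_conv]
    and c = within_edge_cost[OF edge, unfolded e]
    and w = within_edge_weights[OF edge, unfolded e]
  have x: "eval_within rcsp_program ?env (Var 8) (enc_nums (label_vec I p)) 1"
    by (rule within_Var) simp_all
  note vs = within_Cell_nums[OF v within_Cell_nums[OF within_Sub[OF within_Zero v] within_Nil_nums]]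
  note test = within_leq[OF x vs[unfolded e[symmetric]], simplified diff_0 leqs_start_vertex]
  let ?b' = "if start_vertex I p = v then improve I \<eta> U S (e # p) b else b"
  \<comment> \<open>Only for an arc that ends at the start vertex of \<open>p\<close> is the
    computed sum the vector of a path, and only then is this branch evaluated.\<close>
  have upd: "eval_within rcsp_program ?env
      (Call 7 [Var 3, Var 4, Var 5, Var 6, Add (Var 7) ?c,
           Call 1 [One, Cell (Sub ?u ?v) (Cell (Sub ?v ?u) ?w), Var 8],
           Cell (Cell ?u ?v) (Var 9)])
      (enc_best I (improve I \<eta> U S (e # p) b)) (K * (length S + 4) + K + 60)"
    if start: "start_vertex I p = v"
  proof -
    note vec = within_axpy[OF within_One within_Cell_nums[OF within_Sub[OF u v]
          within_Cell_nums[OF within_Sub[OF v u] w]] x[unfolded e]]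
    have "evals_within rcsp_program ?env
      [Var 3, Var 4, Var 5, Var 6, Add (Var 7) ?c,
           Call 1 [One, Cell (Sub ?u ?v) (Cell (Sub ?v ?u) ?w), Var 8],
           Cell (Cell ?u ?v) (Var 9)]
      [enc_labels I S, enc_nums \<eta>, enc_nums U, enc_best I b,
      VNum (path_cost I (e # p)), enc_nums (label_vec I (e # p)), enc_path (e # p)]
      (4 + 9 + (K + 30) + 12)"
    proof -
      have 1: "eval_within rcsp_program ?env (Add (Var 7) ?c) (VNum (path_cost I (e # p))) 9"
        using within_Add[OF within_Var c, of 7 "path_cost I p"] by (simp add: e add.commute)
      have 2: "eval_within rcsp_program ?env
          (Call 1 [One, Cell (Sub ?u ?v) (Cell (Sub ?v ?u) ?w), Var 8])
          (enc_nums (label_vec I (e # p))) (K + 30)"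
        using vec unfolding e[symmetric] label_vec_Cons[OF start, of u, folded e]
        by (rule within_mono) (simp add: K_def)
      have 3: "eval_within rcsp_program ?env (Cell (Cell ?u ?v) (Var 9)) (enc_path (e # p)) 12"
        using within_Cell[OF within_Cell[OF u v] within_Var, of 9 "enc_path p"]
        by (simp add: e within_mono)
      show ?thesis
        by (rule evals_mono[OF within_args_Cons[OF within_Var within_args_Cons[OF within_Var
            within_args_Cons[OF within_Var within_args_Cons[OF within_Var
            within_args_Cons[OF 1 within_args_Cons[OF 2 within_args_Cons[OF 3
            within_args_Nil]]]]]]]]) simp_all
    qed
    from within_Call[OF this _ returns_improve[OF len]] show ?thesis
      by (rule within_mono) (simp_all add: rcsp_program_nth K_def algebra_simps)
  qed
  have b': "eval_within rcsp_program ?env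
      (IfLess Zero (Call 5 [Var 8, Cell ?v (Cell (Sub Zero ?v) Nil0)])
         (Call 7 [Var 3, Var 4, Var 5, Var 6, Add (Var 7) ?c,
           Call 1 [One, Cell (Sub ?u ?v) (Cell (Sub ?v ?u) ?w), Var 8],
           Cell (Cell ?u ?v) (Var 9)])
         (Var 6))
      (enc_best I ?b') (K * (length S + 4) + 2 * K + 100)"
    apply (rule within_mono)
     apply (rule within_If[OF test, of _ _ "K * (length S + 4) + K + 60" _ 1])
    using upd by (auto intro: within_Var[unfolded One_nat_def] simp: e K_def)
  have args: "evals_within rcsp_program ?env
      [Var 1, Var 3, Var 4, Var 5,
       IfLess Zero (Call 5 [Var 8, Cell ?v (Cell (Sub Zero ?v) Nil0)])
         (Call 7 [Var 3, Var 4, Var 5, Var 6, Add (Var 7) ?c,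
           Call 1 [One, Cell (Sub ?u ?v) (Cell (Sub ?v ?u) ?w), Var 8],
           Cell (Cell ?u ?v) (Var 9)])
         (Var 6),
       Var 7, Var 8, Var 9]
      [enc_edges I es, enc_labels I S, enc_nums \<eta>, enc_nums U, enc_best I ?b',
      VNum (path_cost I p), enc_nums (label_vec I p), enc_path p]
      (K * (length S + 4) + 2 * K + 107)"
    by (rule evals_mono[OF within_args_Cons[OF within_Var within_args_Cons[OF within_Var
            within_args_Cons[OF within_Var within_args_Cons[OF within_Var
            within_args_Cons[OF b' within_args_Cons[OF within_Var within_args_Cons[OF within_Var
            within_args_Cons[OF within_Var within_args_Nil]]]]]]]]]) simp_all
  have "100 \<le> K" by (simp add: K_def)
  have fold: "scan_edges I \<eta> U (e # es) S p b = scan_edges I \<eta> U es S p ?b'"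
    by (simp add: scan_edges_def e)
  show ?case
    unfolding rcsp_program_nth scan_edges_body_def fold Let_def
    apply (rule within_mono, rule within_CaseList_Cons, rule within_Var, simp, simp)
     apply (rule within_Call[OF args _ Cons.IH])
     apply (simp add: rcsp_program_nth)
    using \<open>100 \<le> K\<close> by (simp add: algebra_simps)
qed

lemma returns_scan_labels:
  assumes len: "length \<eta> = resources I + 2"
  defines "K \<equiv> 20 * (resources I + 3) + 40"
  shows "returns [enc_labels I R, enc_labels I S, enc_edges I es, enc_nums \<eta>, enc_nums U,
      enc_best I b] 9
     (enc_best I (scan_labels I \<eta> U es S R b))
     (K * (length S + 9) * (length es + 2) * (length R + 1))"
proof (induction R arbitrary: b)
  case Nil
  have "3 \<le> K * (length S + 9)" by (simp add: K_def algebra_simps)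
  then show ?case
    unfolding rcsp_program_nth scan_labels_body_def
    apply (intro within_mono[where A = 3
          and B = "K * (length S + 9) * (length es + 2) * (length [] + 1)"])
     apply (rule within_mono, rule within_CaseList_Nil, rule within_Var, simp, simp)
      apply (rule within_Var)
        apply (simp_all add: scan_labels_def algebra_simps)
    done
next
  case (Cons p R)
  let ?env = "[enc_label I p, enc_labels I R, enc_labels I (p # R), enc_labels I S,
      enc_edges I es, enc_nums \<eta>, enc_nums U, enc_best I b]"
  let ?b' = "scan_edges I \<eta> U es S p b"
  let ?args = "[Var 4, Var 3, Var 5, Var 6, Var 7,
       Head (Var 0), Head (Tail (Var 0)), Tail (Tail (Var 0))]"
  have label: "eval_within rcsp_program ?env (Var 0) (enc_label I p) 1"
    by (rule within_Var) simp_all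
  have "evals_within rcsp_program ?env ?args
      [enc_edges I es, enc_labels I S, enc_nums \<eta>, enc_nums U, enc_best I b,
      VNum (path_cost I p), enc_nums (label_vec I p), enc_path p] 20"
    by (rule evals_mono[OF within_args_Cons[OF within_Var within_args_Cons[OF within_Var
            within_args_Cons[OF within_Var within_args_Cons[OF within_Var
            within_args_Cons[OF within_Var within_args_Cons[OF within_label_cost[OF label]
            within_args_Cons[OF within_label_vec[OF label]
            within_args_Cons[OF within_label_path[OF label] within_args_Nil]]]]]]]]]) simp_all
  from within_Call[OF this _ returns_scan_edges[OF len, folded K_def]]
  have b': "eval_within rcsp_program ?env (Call 8 ?args) (enc_best I ?b')
      (20 + K * (length S + 9) * (length es + 1) + 1)"
    by (simp add: rcsp_program_nth)
  have args: "evals_within rcsp_program ?env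
      [Var 1, Var 3, Var 4, Var 5, Var 6, Call 8 ?args]
      [enc_labels I R, enc_labels I S, enc_edges I es, enc_nums \<eta>, enc_nums U, enc_best I ?b']
      (K * (length S + 9) * (length es + 1) + 26)"
    by (rule evals_mono[OF within_args_Cons[OF within_Var within_args_Cons[OF within_Var
            within_args_Cons[OF within_Var within_args_Cons[OF within_Var
            within_args_Cons[OF within_Var within_args_Cons[OF b' within_args_Nil]]]]]]]) simp_all
  have "100 \<le> K" by (simp add: K_def)
  have fold: "scan_labels I \<eta> U es S (p # R) b = scan_labels I \<eta> U es S R ?b'"
    by (simp add: scan_labels_def)
  show ?case
    unfolding rcsp_program_nth scan_labels_body_def fold
    apply (rule within_mono, rule within_CaseList_Cons, rule within_Var, simp, simp)
     apply (rule within_Call[OF args _ Cons.IH])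
     apply (simp add: rcsp_program_nth)
    using \<open>100 \<le> K\<close> by (simp add: algebra_simps)
qed

text \<open>That the recursion ends depends on the search invariant. Here and in the next lemma a
  single round is unfolded; \<open>settle_terminates\<close> chains the rounds.\<close>

lemma returns_settle_stop:
  assumes len: "length \<eta> = resources I + 2"
    and none: "scan_labels I \<eta> U es S S None = None"
  shows "returns [enc_labels I S, enc_edges I es, enc_nums \<eta>, enc_nums U] 10 (enc_labels I S)
     ((20 * (resources I + 3) + 40) * (length S + 9) * (length es + 2) * (length S + 1) + 20)"
proof -
  let ?B = "(20 * (resources I + 3) + 40) * (length S + 9) * (length es + 2) * (length S + 1)"
  let ?env = "[enc_labels I S, enc_edges I es, enc_nums \<eta>, enc_nums U]"
  have "evals_within rcsp_program ?env [Var 0, Var 0, Var 1, Var 2, Var 3, Nil0]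
      [enc_labels I S, enc_labels I S, enc_edges I es, enc_nums \<eta>, enc_nums U, enc_best I None] 6"
    unfolding enc_best_def option.case
    by (rule evals_mono[OF within_args_Cons[OF within_Var within_args_Cons[OF within_Var
            within_args_Cons[OF within_Var within_args_Cons[OF within_Var
            within_args_Cons[OF within_Var within_args_Cons[OF within_Nil0
            within_args_Nil]]]]]]]) simp_all
  note call = within_Call[OF this _ returns_scan_labels[OF len],
      unfolded none enc_best_def option.case]
  have b: "eval_within rcsp_program ?env (Call 9 [Var 0, Var 0, Var 1, Var 2, Var 3, Nil0]) VNil
      (?B + 7)"
    by (rule within_mono[OF call]) (simp_all add: rcsp_program_nth)
  show ?thesis
    unfolding rcsp_program_nth settle_body_def
    apply (rule within_mono, rule within_LetIn[OF b], rule within_CaseList_Nil)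
      apply (rule within_Var, simp, simp)
     apply (rule within_Var, simp, simp)
    by simp
qed

lemma returns_settle_step:
  assumes len: "length \<eta> = resources I + 2"
    and some: "scan_labels I \<eta> U es S S None = Some q"
    and rest: "returns [enc_labels I (q # S), enc_edges I es, enc_nums \<eta>, enc_nums U] 10 v T"
  shows "returns [enc_labels I S, enc_edges I es, enc_nums \<eta>, enc_nums U] 10 v
     ((20 * (resources I + 3) + 40) * (length S + 9) * (length es + 2) * (length S + 1) + 20 + T)"
proof -
  let ?B = "(20 * (resources I + 3) + 40) * (length S + 9) * (length es + 2) * (length S + 1)"
  let ?env = "[enc_labels I S, enc_edges I es, enc_nums \<eta>, enc_nums U]"
  have "evals_within rcsp_program ?env [Var 0, Var 0, Var 1, Var 2, Var 3, Nil0]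
      [enc_labels I S, enc_labels I S, enc_edges I es, enc_nums \<eta>, enc_nums U, enc_best I None] 6"
    unfolding enc_best_def option.case
    by (rule evals_mono[OF within_args_Cons[OF within_Var within_args_Cons[OF within_Var
            within_args_Cons[OF within_Var within_args_Cons[OF within_Var
            within_args_Cons[OF within_Var within_args_Cons[OF within_Nil0
            within_args_Nil]]]]]]]) simp_all
  note call = within_Call[OF this _ returns_scan_labels[OF len],
      unfolded some enc_best_def option.case]
  have b: "eval_within rcsp_program ?env (Call 9 [Var 0, Var 0, Var 1, Var 2, Var 3, Nil0])
      (enc_label I q) (?B + 7)"
    by (rule within_mono[OF call]) (simp_all add: rcsp_program_nth)
  let ?x = "VNum (path_cost I q)" and ?y = "VCons (enc_nums (label_vec I q)) (enc_path q)"
  have args: "evals_within rcsp_program (?x # ?y # enc_label I q # ?env)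
      [Cell (Var 2) (Var 3), Var 4, Var 5, Var 6]
      [enc_labels I (q # S), enc_edges I es, enc_nums \<eta>, enc_nums U] 6"
    unfolding enc_labels_simps
    by (rule evals_mono[OF within_args_Cons[OF within_Cell[OF within_Var within_Var]
            within_args_Cons[OF within_Var within_args_Cons[OF within_Var
            within_args_Cons[OF within_Var within_args_Nil]]]]]) simp_all
  show ?thesis
    unfolding rcsp_program_nth settle_body_def
    apply (rule within_mono, rule within_LetIn[OF b], rule within_CaseList_Cons[of _ _ _ ?x ?y])
      apply (rule within_Var, simp, simp add: enc_label_def)
     apply (rule within_Call[OF args _ rest])
     apply (simp add: rcsp_program_nth)
    by simp
qed

lemma returns_select:
  "returns [enc_labels I S, enc_nums g, enc_path b] 11 (enc_path (select I g S b))
     ((20 * (resources I + 3) + 40) * (length S + 1))"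
proof (induction S arbitrary: b)
  case Nil
  show ?case
    unfolding rcsp_program_nth select_body_def
    apply (rule within_mono, rule within_CaseList_Nil, rule within_Var, simp, simp)
     apply (rule within_Var)
    by (simp_all add: select_def)
next
  case (Cons p S)
  let ?env = "[enc_label I p, enc_labels I S, enc_labels I (p # S), enc_nums g, enc_path b]"
  let ?b' = "if leqs (label_vec I p) g then p else b"
  have label: "eval_within rcsp_program ?env (Var 0) (enc_label I p) 1"
    by (rule within_Var) simp_all
  have g: "eval_within rcsp_program ?env (Var 3) (enc_nums g) 1"
    by (rule within_Var) simp_all
  have b': "eval_within rcsp_program ?env
      (IfLess Zero (Call 5 [Head (Tail (Var 0)), Var 3]) (Tail (Tail (Var 0))) (Var 4))
      (enc_path ?b') (20 * (resources I + 3) + 20)"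
    apply (rule within_mono)
     apply (rule within_If[OF within_leq[OF within_label_vec[OF label] g], of _ _ 5 _ 1])
    using within_label_path[OF label] by (auto intro: within_Var[unfolded One_nat_def])
  have args: "evals_within rcsp_program ?env [Var 1, Var 3,
        IfLess Zero (Call 5 [Head (Tail (Var 0)), Var 3]) (Tail (Tail (Var 0))) (Var 4)]
      [enc_labels I S, enc_nums g, enc_path ?b'] (20 * (resources I + 3) + 22)"
    by (rule evals_mono[OF within_args_Cons[OF within_Var within_args_Cons[OF within_Var
            within_args_Cons[OF b' within_args_Nil]]]]) simp_all
  have fold: "select I g (p # S) b = select I g S ?b'"
    by (simp add: select_def)
  show ?case
    unfolding rcsp_program_nth select_body_def fold
    apply (rule within_mono, rule within_CaseList_Cons, rule within_Var, simp, simp)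
     apply (rule within_Call[OF args _ Cons.IH])
     apply (simp add: rcsp_program_nth)
    by (simp add: algebra_simps)
qed

section \<open>The vectors prepared by the main function, and its running time\<close>

definition budgets :: "rcsp \<Rightarrow> real list" where
  "budgets I = map (budget I) [0..<resources I]"

definition slacks :: "rcsp \<Rightarrow> (nat \<Rightarrow> real) \<Rightarrow> real list" where
  "slacks I \<epsilon> = map (\<lambda>i. budget I i * \<epsilon> i) [0..<resources I]"

definition relaxed_budgets :: "rcsp \<Rightarrow> (nat \<Rightarrow> real) \<Rightarrow> real list" where
  "relaxed_budgets I \<epsilon> = axpy 1 (slacks I \<epsilon>) (budgets I)"

definition zeros :: "rcsp \<Rightarrow> real list" where
  "zeros I = map (\<lambda>_. 0) [0..<resources I]"

definition goal :: "rcsp \<Rightarrow> (nat \<Rightarrow> real) \<Rightarrow> real list" where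
  "goal I \<epsilon> = real (source I) # - real (source I) # relaxed_budgets I \<epsilon>"

text \<open>The two leading zeros grant no slack to the vertex entries, so domination still requires
  equal start vertices.\<close>

definition trim :: "rcsp \<Rightarrow> (nat \<Rightarrow> real) \<Rightarrow> real list" where
  "trim I \<epsilon> = 0 # 0 # axpy (1 / real (num_verts I)) (slacks I \<epsilon>) (zeros I)"

text \<open>Fewer than \<open>n\<close> arcs precede a label on a path, and each weighs at least the minimum weight. Hence
  a label above these limits cannot be completed within the relaxed budgets.\<close>

definition limits :: "rcsp \<Rightarrow> (nat \<times> nat) list \<Rightarrow> (nat \<Rightarrow> real) \<Rightarrow> real list" where
  "limits I es \<epsilon> = real (num_verts I) # 0 #
     axpy (- real (num_verts I)) (min_weights I es (zeros I)) (relaxed_budgets I \<epsilon>)"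

lemma length_vectors [simp]:
  "length (budgets I) = resources I" "length (slacks I \<epsilon>) = resources I"
  "length (zeros I) = resources I" "length (relaxed_budgets I \<epsilon>) = resources I"
  "length (trim I \<epsilon>) = resources I + 2"
  by (simp_all add: budgets_def slacks_def zeros_def relaxed_budgets_def trim_def)

lemma enc_input_eq:
  "enc_input I es \<epsilon> =
     [VNum (real (num_verts I)), VNum (real (resources I)), VNum (real (source I)),
      VNum (real (target I)), enc_edges I es, enc_nums (budgets I),
      enc_nums (map \<epsilon> [0..<resources I])]"
  by (simp add: enc_input_def enc_edges_def budgets_def enc_nums_def comp_def)

lemma slacks_eq: "map2 (*) (budgets I) (map \<epsilon> [0..<resources I]) = slacks I \<epsilon>"
  by (simp add: slacks_def budgets_def zip_map_map zip_same_conv_map)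

lemma zeros_eq: "axpy (0 - 1) (budgets I) (budgets I) = zeros I"
  by (simp add: zeros_def budgets_def axpy_def zip_map_map zip_same_conv_map)

lemma enc_start_label:
  "enc_labels I [[]] = VCons (VCons (VNum 0) (VCons (enc_nums (real (target I) #
     (0 - real (target I)) # zeros I)) VNil)) VNil"
  by (simp add: enc_label_def label_vec_def zeros_def)

lemma main_trivial:
  assumes "num_verts I \<le> 1"
  shows "eval_within rcsp_program (enc_input I es \<epsilon>) main_body (enc_path []) 4"
  unfolding enc_input_eq main_body_def
  apply (rule within_mono)
   apply (rule within_IfLess[where x = 1 and y = "real (num_verts I)" and C = 1 and D = 1])
      apply (rule within_One)
     apply (rule within_Var, simp, simp)
  using assms within_Nil0 by simp_all

lemma main_search:
  assumes n: "1 < num_verts I"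
    and settle: "returns [enc_labels I [[]], enc_edges I es, enc_nums (trim I \<epsilon>),
        enc_nums (limits I es \<epsilon>)] 10 (enc_labels I S) T"
  shows "eval_within rcsp_program (enc_input I es \<epsilon>) main_body (enc_path (select I (goal I \<epsilon>) S []))
    (T + (20 * (resources I + 3) + 40) * (length es + length S + 10))"
proof -
  let ?env = "enc_input I es \<epsilon>"
  let ?m = "resources I"
  let ?n = "num_verts I"
  let ?env1 = "enc_nums (slacks I \<epsilon>) # ?env"
  let ?env2 = "enc_nums (zeros I) # ?env1"
  let ?env3 = "enc_nums (relaxed_budgets I \<epsilon>) # ?env2"
  let ?env4 = "enc_labels I S # ?env3"
  note [simp] = enc_input_eq
  note vars = within_Var[where P = rcsp_program]
  have 1: "eval_within rcsp_program ?env (Call 2 [Var 5, Var 6]) (enc_nums (slacks I \<epsilon>))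
      (20 * (?m + 1) + 3)"
    by (rule within_mono, rule within_mul[of _ _ "budgets I" _ _ "map \<epsilon> [0..<?m]",
          unfolded slacks_eq]) (rule vars | simp)+
  have 2: "eval_within rcsp_program ?env1 (Call 1 [Sub Zero One, Var 6, Var 6])
      (enc_nums (zeros I)) (20 * (?m + 1) + 10)"
    by (rule within_mono, rule within_axpy[of _ _ "0 - 1" _ _ "budgets I" _ _ "budgets I",
          unfolded zeros_eq], rule within_Sub[OF within_Zero within_One]) (rule vars | simp)+
  have 3: "eval_within rcsp_program ?env2 (Call 1 [One, Var 1, Var 7])
      (enc_nums (relaxed_budgets I \<epsilon>)) (20 * (?m + 1) + 10)"
    unfolding relaxed_budgets_def
    by (rule within_mono, rule within_axpy, rule within_One) (rule vars | simp)+
  have trim: "eval_within rcsp_program ?env3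
      (Cell Zero (Cell Zero (Call 1 [Div One (Var 3), Var 2, Var 1])))
      (enc_nums (trim I \<epsilon>)) (20 * (?m + 1) + 20)"
    unfolding trim_def
    by (rule within_mono, rule within_Cell_nums, rule within_Zero, rule within_Cell_nums,
        rule within_Zero, rule within_axpy, rule within_Div, rule within_One)
      (rule vars | use n in simp)+
  have min_weights: "eval_within rcsp_program ?env3 (Call 4 [Var 7, Var 1])
      (enc_nums (min_weights I es (zeros I))) (20 * (?m + 3) * (length es + 1) + 3)"
    by (rule within_mono, rule within_Call[OF within_args_Cons[OF vars within_args_Cons[OF vars
            within_args_Nil]] _ returns_min_weights[of "zeros I"]])
      (simp_all add: rcsp_program_nth)
  have limits: "eval_within rcsp_program ?env3
      (Cell (Var 3) (Cell Zero (Call 1 [Sub Zero (Var 3), Call 4 [Var 7, Var 1], Var 0])))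
      (enc_nums (limits I es \<epsilon>)) (20 * (?m + 3) * (length es + 1) + 20 * (?m + 1) + 20)"
    unfolding limits_def
    apply (rule within_mono, rule within_Cell_nums, rule vars, simp, simp,
        rule within_Cell_nums, rule within_Zero)
     apply (rule within_axpy[OF within_Sub[OF within_Zero vars, of _ _ "real ?n",
            unfolded diff_0] min_weights vars])
    by (simp_all add: length_min_weights)
  have start: "eval_within rcsp_program ?env3
      (Cell (Cell Zero (Cell (Cell (Var 6) (Cell (Sub Zero (Var 6)) (Var 1))) Nil0)) Nil0)
      (enc_labels I [[]]) 20"
    unfolding enc_start_label
    by (rule within_mono, rule within_Cell, rule within_Cell, rule within_Zero,
        rule within_Cell, rule within_Cell_nums, rule vars, simp, simp,
        rule within_Cell_nums, rule within_Sub, rule within_Zero)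
      (rule vars within_Nil0 | simp)+
  have edges: "eval_within rcsp_program ?env3 (Var 7) (enc_edges I es) 1"
    by (rule vars) simp_all
  note 4 = within_Call[OF within_args_Cons[OF start within_args_Cons[OF edges
        within_args_Cons[OF trim within_args_Cons[OF limits within_args_Nil]]]] _ settle]
  have goal: "eval_within rcsp_program ?env4 (Cell (Var 6) (Cell (Sub Zero (Var 6)) (Var 1)))
      (enc_nums (goal I \<epsilon>)) 10"
    unfolding goal_def diff_0[symmetric]
    by (rule within_mono, rule within_Cell_nums, rule vars, simp, simp,
        rule within_Cell_nums, rule within_Sub, rule within_Zero)
      (rule vars | simp)+
  have labels: "eval_within rcsp_program ?env4 (Var 0) (enc_labels I S) 1"
    by (rule vars) simp_all
  have nil: "eval_within rcsp_program ?env4 Nil0 (enc_path []) 1"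
    using within_Nil0 by simp
  note 5 = within_Call[OF within_args_Cons[OF labels within_args_Cons[OF goal
        within_args_Cons[OF nil within_args_Nil]]] _ returns_select]
  \<comment> \<open>The bound is spelled out in the nesting that the evaluation rules produce, so
    that they unify with it; it is simplified only in the final step.\<close>
  have body: "eval_within rcsp_program ?env main_body (enc_path (select I (goal I \<epsilon>) S [])) B"
    if B: "B = 1 + 1 + max (20 * (?m + 1) + 3 + (20 * (?m + 1) + 10 + (20 * (?m + 1) + 10 +
      ((20 + (1 + (20 * (?m + 1) + 20 +
        (20 * (?m + 3) * (length es + 1) + 20 * (?m + 1) + 20 + 0)))) + T + 1
        + ((1 + (10 + (1 + 0))) + (20 * (?m + 3) + 40) * (length S + 1) + 1) + 1) + 1) + 1) + 1)
      1 + 1" for B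
    unfolding main_body_def B
    apply (rule within_IfLess[where x = 1 and y = "real ?n"])
       apply (rule within_One)
      apply (rule vars, simp, simp)
     apply (rule within_LetIn[OF 1 within_LetIn[OF 2 within_LetIn[OF 3 within_LetIn[OF 4 5]]]])
    using n by (simp_all add: rcsp_program_nth)
  show ?thesis
    by (rule within_mono[OF body[OF refl]]) (simp add: algebra_simps)
qed

section \<open>Correctness of the search\<close>

definition min_weight :: "rcsp \<Rightarrow> nat \<Rightarrow> real" where
  "min_weight I i = Min (insert 0 (weight I i ` parcs (graph I)))"

definition cell_width :: "rcsp \<Rightarrow> (nat \<Rightarrow> real) \<Rightarrow> nat \<Rightarrow> real" where
  "cell_width I \<epsilon> i = budget I i * \<epsilon> i / real (num_verts I)"

definition candidates ::
    "rcsp \<Rightarrow> (nat \<times> nat) list \<Rightarrow> (nat \<times> nat) list list \<Rightarrow> (nat \<times> nat) list set" where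
  "candidates I es S = {e # p | e p. e \<in> set es \<and> p \<in> set S \<and> start_vertex I p = snd e}"

definition trim_dominates ::
    "rcsp \<Rightarrow> (nat \<Rightarrow> real) \<Rightarrow> (nat \<times> nat) list \<Rightarrow> (nat \<times> nat) list \<Rightarrow> bool" where
  "trim_dominates I \<epsilon> a q \<longleftrightarrow> path_cost I a \<le> path_cost I q \<and> start_vertex I a = start_vertex I q \<and>
     (\<forall>i<resources I. path_weight I i a \<le> path_weight I i q + cell_width I \<epsilon> i)"

definition within_limits :: "rcsp \<Rightarrow> (nat \<Rightarrow> real) \<Rightarrow> (nat \<times> nat) list \<Rightarrow> bool" where
  "within_limits I \<epsilon> q \<longleftrightarrow> (\<forall>i<resources I. path_weight I i q \<le>
     budget I i + budget I i * \<epsilon> i - real (num_verts I) * min_weight I i)"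

section \<open>Vector tests read as statements about vertices and weights\<close>

lemma path_weight_append: "path_weight I i (p @ q) = path_weight I i p + path_weight I i q"
  and path_cost_append: "path_cost I (p @ q) = path_cost I p + path_cost I q"
  by (simp_all add: path_weight_def path_cost_def)

lemma leqs_map:
  "leqs (map f [0..<m]) (map g [0..<m]) \<longleftrightarrow> (\<forall>i<m. f i \<le> g i)"
  by (auto simp: leqs_def zip_map_map zip_same_conv_map)

lemma axpy_map: "axpy a (map f [0..<m]) (map g [0..<m]) = map (\<lambda>i. a * f i + g i) [0..<m]"
  by (simp add: axpy_def zip_map_map zip_same_conv_map)

lemma min_weights_map:
  "min_weights I es (map f [0..<resources I]) =
     map (\<lambda>i. Min (insert (f i) (weight I i ` set es))) [0..<resources I]"
proof (induction es arbitrary: f)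
  case Nil
  then show ?case by (simp add: min_weights_def)
next
  case (Cons e es)
  have "min_weights I (e # es) (map f [0..<resources I]) =
    min_weights I es (map (\<lambda>i. min (f i) (weight I i e)) [0..<resources I])"
    by (simp add: min_weights_def edge_weights_def zip_map_map zip_same_conv_map comp_def)
  also have "\<dots> = map (\<lambda>i. Min (insert (min (f i) (weight I i e)) (weight I i ` set es)))
      [0..<resources I]"
    by (rule Cons)
  also have "\<dots> = map (\<lambda>i. Min (insert (f i) (weight I i ` set (e # es)))) [0..<resources I]"
  proof -
    have "Min (insert (min a b) X) = Min (insert a (insert b X))" if "finite X"
      for a b :: real and X
      using that by (cases "X = {}") (simp_all add: min.assoc)
    then show ?thesis by simp
  qed
  finally show ?case .
qed

lemma relaxed_budgets_eq:
  "relaxed_budgets I \<epsilon> = map (\<lambda>i. budget I i + budget I i * \<epsilon> i) [0..<resources I]"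
  by (simp add: relaxed_budgets_def slacks_def budgets_def axpy_map add.commute)

lemma leqs_goal:
  "leqs (label_vec I p) (goal I \<epsilon>) \<longleftrightarrow> start_vertex I p = source I \<and>
     (\<forall>i<resources I. path_weight I i p \<le> budget I i + budget I i * \<epsilon> i)"
  by (auto simp: label_vec_def goal_def relaxed_budgets_eq leqs_map)

lemma leqs_trim:
  "leqs (label_vec I a) (axpy 1 (trim I \<epsilon>) (label_vec I q)) \<longleftrightarrow>
     start_vertex I a = start_vertex I q \<and>
     (\<forall>i<resources I. path_weight I i a \<le> path_weight I i q + cell_width I \<epsilon> i)"
  by (auto simp: label_vec_def trim_def slacks_def zeros_def axpy_map leqs_map cell_width_def
      add.commute)

text \<open>Loop invariant of the scans: \<open>X\<close> holds the candidates inspected so far, and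
  \<open>b\<close> is a cheapest admissible one among them.\<close>

definition best_of ::
    "(nat \<times> nat) list option \<Rightarrow> rcsp \<Rightarrow> ((nat \<times> nat) list \<Rightarrow> bool) \<Rightarrow> (nat \<times> nat) list set \<Rightarrow> bool" where
  "best_of b I A X \<longleftrightarrow> (case b of None \<Rightarrow> \<forall>q\<in>X. \<not> A q
     | Some r \<Rightarrow> r \<in> X \<and> A r \<and> (\<forall>q\<in>X. A q \<longrightarrow> path_cost I r \<le> path_cost I q))"

lemma best_of_improve:
  assumes "best_of b I (admissible I \<eta> U S) X"
  shows "best_of (improve I \<eta> U S q b) I (admissible I \<eta> U S) (insert q X)"
  using assms by (fastforce simp: best_of_def improve_def split: option.splits)

lemma best_of_scan_edges:
  assumes "best_of b I (admissible I \<eta> U S) X"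
  shows "best_of (scan_edges I \<eta> U es S p b) I (admissible I \<eta> U S)
    (X \<union> {e # p | e. e \<in> set es \<and> start_vertex I p = snd e})"
  using assms
proof (induction es arbitrary: b X)
  case Nil
  then show ?case by (simp add: scan_edges_def)
next
  case (Cons e es)
  let ?Y = "if start_vertex I p = snd e then insert (e # p) X else X"
  have "best_of (if start_vertex I p = snd e then improve I \<eta> U S (e # p) b else b) I
      (admissible I \<eta> U S) ?Y"
    using best_of_improve[OF Cons.prems] Cons.prems by simp
  from Cons.IH[OF this]
  have "best_of (scan_edges I \<eta> U (e # es) S p b) I (admissible I \<eta> U S)
    (?Y \<union> {e # p | e. e \<in> set es \<and> start_vertex I p = snd e})"
    by (simp add: scan_edges_def)
  also have "?Y \<union> {e # p | e. e \<in> set es \<and> start_vertex I p = snd e} =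
    X \<union> {e' # p | e'. e' \<in> set (e # es) \<and> start_vertex I p = snd e'}"
    by (auto simp del: split_paired_Ex)
  finally show ?case .
qed

lemma best_of_scan_labels:
  assumes "best_of b I (admissible I \<eta> U S) X"
  shows "best_of (scan_labels I \<eta> U es S R b) I (admissible I \<eta> U S) (X \<union> candidates I es R)"
  using assms
proof (induction R arbitrary: b X)
  case Nil
  then show ?case by (simp add: scan_labels_def candidates_def)
next
  case (Cons p R)
  from Cons.IH[OF best_of_scan_edges[OF Cons.prems]]
  have "best_of (scan_labels I \<eta> U es S (p # R) b) I (admissible I \<eta> U S)
    (X \<union> {e # p | e. e \<in> set es \<and> start_vertex I p = snd e} \<union> candidates I es R)"
    by (simp add: scan_labels_def)
  also have "X \<union> {e # p | e. e \<in> set es \<and> start_vertex I p = snd e} \<union> candidates I es R =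
      X \<union> candidates I es (p # R)"
    by (auto simp: candidates_def)
  finally show ?case .
qed

text \<open>Newer labels stand in front, so costs do not increase along the list. The fold keeps the
  last match, which is therefore a cheapest one.\<close>

lemma select_cheapest:
  assumes "sorted_wrt (\<lambda>b a. path_cost I a \<le> path_cost I b) S"
    and "\<exists>a\<in>set S. leqs (label_vec I a) g"
  shows "select I g S b \<in> set S \<and> leqs (label_vec I (select I g S b)) g \<and>
    (\<forall>a\<in>set S. leqs (label_vec I a) g \<longrightarrow> path_cost I (select I g S b) \<le> path_cost I a)"
  using assms
proof (induction S arbitrary: b)
  case Nil
  then show ?case by simp
next
  case (Cons p S)
  let ?b' = "if leqs (label_vec I p) g then p else b"
  have step: "select I g (p # S) b = select I g S ?b'" by (simp add: select_def)
  show ?case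
  proof (cases "\<exists>a\<in>set S. leqs (label_vec I a) g")
    case True
    then show ?thesis using Cons.IH[of ?b'] Cons.prems unfolding step by auto
  next
    case False
    then have "select I g S c = c" for c
      unfolding select_def by (induction S arbitrary: c) auto
    then show ?thesis using False Cons.prems unfolding step by auto
  qed
qed

locale rcsp_search =
  fixes I :: rcsp and es :: "(nat \<times> nat) list" and \<epsilon> :: "nat \<Rightarrow> real"
  assumes inst: "rcsp_instance I" and tol: "tolerances I \<epsilon>" and edges: "set es = parcs (graph I)"
begin

sublocale pair_fin_digraph "graph I"
  using inst by (simp add: rcsp_instance_def)

abbreviation "adm \<equiv> admissible I (trim I \<epsilon>) (limits I es \<epsilon>)"

abbreviation "n \<equiv> num_verts I"
abbreviation "\<eta> \<equiv> cell_width I \<epsilon>"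

lemma n_pos: "0 < n"
  using inst pair_finite_verts unfolding rcsp_instance_def by (auto simp: card_gt_0_iff)

lemma slack_pos: "i < resources I \<Longrightarrow> 0 < budget I i * \<epsilon> i"
  using tol by (simp add: tolerances_def)

lemma cell_width_pos: "i < resources I \<Longrightarrow> 0 < \<eta> i"
  using slack_pos n_pos by (simp add: cell_width_def)

lemma n_cell_width: "real n * \<eta> i = budget I i * \<epsilon> i"
proof -
  have "real n \<noteq> 0" using n_pos by linarith
  then show ?thesis unfolding cell_width_def by (rule nonzero_mult_div_cancel_left[of "real n", folded times_divide_eq_right])
qed

lemma edge_cost_nonneg: "e \<in> set es \<Longrightarrow> 0 \<le> edge_cost I e"
  using inst edges by (simp add: rcsp_instance_def)

lemma min_weight_le: "e \<in> parcs (graph I) \<Longrightarrow> min_weight I i \<le> weight I i e"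
  and min_weight_nonpos: "min_weight I i \<le> 0"
  using pair_finite_arcs by (auto simp: min_weight_def)

lemma min_weights_zeros:
  "min_weights I es (zeros I) = map (min_weight I) [0..<resources I]"
  by (simp add: zeros_def min_weights_map min_weight_def edges)

text \<open>The leading entries \<open>n\<close> and \<open>0\<close> of the limits hold for every
  vertex number up to \<open>n\<close>, so only the weights are really tested.\<close>

lemma leqs_limits:
  assumes "start_vertex I p \<le> n"
  shows "leqs (label_vec I p) (limits I es \<epsilon>) \<longleftrightarrow> within_limits I \<epsilon> p"
  using assms
  by (auto simp: label_vec_def limits_def min_weights_zeros relaxed_budgets_eq axpy_map leqs_map
      within_limits_def algebra_simps)

lemma start_vertex_less:
  assumes "e \<in> set es"
  shows "fst e < n"
  using arc_fst_in_verts[of e] assms edges inst by (auto simp: rcsp_instance_def)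

lemma admissible_iff:
  assumes "q \<in> candidates I es S"
  shows "adm S q \<longleftrightarrow> within_limits I \<epsilon> q \<and> \<not> (\<exists>a\<in>set S. trim_dominates I \<epsilon> a q)"
proof -
  have "start_vertex I q \<le> n"
    using assms start_vertex_less by (fastforce simp: candidates_def)
  then show ?thesis
    by (auto simp: admissible_def leqs_limits dominated_def leqs_trim trim_dominates_def)
qed

lemma best_of_candidates:
  "best_of (scan_labels I (trim I \<epsilon>) (limits I es \<epsilon>) es S S None) I (adm S) (candidates I es S)"
  using best_of_scan_labels[of None I _ _ S "{}"] by (simp add: best_of_def)

text \<open>A simple path has fewer than \<open>n\<close> arcs, and since \<open>min_weight\<close>
  is nonpositive, replacing the length by \<open>n\<close> only lowers the bound.\<close>

lemma path_weight_lower: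
  assumes "apath u p v"
  shows "real n * min_weight I i \<le> path_weight I i p"
proof -
  have "set p \<subseteq> parcs (graph I)" using assms by (auto simp: apath_def)
  then have "real (length p) * min_weight I i \<le> path_weight I i p"
  proof (induction p)
    case (Cons e p)
    then show ?case using min_weight_le[of e i] by (simp add: distrib_right)
  qed simp
  moreover have "real n * min_weight I i \<le> real (length p) * min_weight I i"
    using length_apath_less[OF assms] min_weight_nonpos by (intro mult_right_mono_neg) auto
  ultimately show ?thesis by simp
qed

lemma start_vertex_awalk: "awalk u p (target I) \<Longrightarrow> start_vertex I p = u"
  by (cases p) (auto simp: awalk_simps)

text \<open>If an extension revisits a vertex, it closes a cycle. Since cycles have nonnegative cost and
  weights, the extension is dominated by its own suffix starting at the revisited vertex.\<close>

lemma extension_apath: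
  assumes p: "apath (start_vertex I p) p (target I)"
    and e: "e \<in> set es" "start_vertex I p = snd e"
    and suffixes: "\<And>q r. p = q @ r \<Longrightarrow> \<not> trim_dominates I \<epsilon> r (e # p)"
  shows "apath (fst e) (e # p) (target I)"
proof -
  have "fst e \<notin> set (pawalk_verts (snd e) p)"
  proof
    assume revisit: "fst e \<in> set (pawalk_verts (snd e) p)"
    have "awalk (snd e) p (target I)" using p e by (simp add: apath_def)
    from awalk_decomp[OF this revisit] obtain q r
      where qr: "p = q @ r" "awalk (snd e) q (fst e)" "awalk (fst e) r (target I)" by blast
    have "apath (snd e) (q @ r) (target I)" using p e qr by simp
    \<comment> \<open>The vertices of \<open>q\<close> are those of the closed walk
      \<open>e # q\<close> without the first one, and these are the ones that \<open>cycle\<close>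
      requires to be distinct.\<close>
    then have "distinct (pawalk_verts (snd e) q)"
      unfolding apath_append_iff by (simp add: apath_def)
    then have "cycle (e # q)"
      using qr e edges unfolding cycle_def
      by (intro exI[of _ "fst e"]) (auto simp: awalk_Cons_iff)
    then have "0 \<le> path_weight I i (e # q)" if "i < resources I" for i
      using inst that unfolding rcsp_instance_def path_weight_def by blast
    moreover have "0 \<le> path_cost I (e # q)"
    proof -
      have "set (e # q) \<subseteq> set es" using qr e edges by auto
      then show ?thesis
        unfolding path_cost_def
        by (intro sum_list_nonneg) (use edge_cost_nonneg in \<open>unfold set_map, blast\<close>)
    qed
    moreover have "path_cost I (e # p) = path_cost I (e # q) + path_cost I r"
      "path_weight I i (e # p) = path_weight I i (e # q) + path_weight I i r" for i
      by (simp_all add: qr(1) path_weight_append path_cost_append)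
    moreover have "0 \<le> \<eta> i" if "i < resources I" for i
      using cell_width_pos[OF that] by simp
    ultimately have "trim_dominates I \<epsilon> r (e # p)"
      using start_vertex_awalk[OF qr(3)]
      by (simp del: path_weight_simps path_cost_simps add: trim_dominates_def add_increasing2 add_increasing)
    then show False using suffixes qr(1) by blast
  qed
  then show ?thesis using p e edges by (simp add: apath_Cons_iff)
qed

text \<open>The invariant of the search, newest label first. In \<open>sorted_wrt\<close>,
  \<open>b\<close> is newer than \<open>a\<close>, so no label is trim-dominated by an older one.
  The empty label is exempt from the limits, which it can violate when a budget is negative. The
  last clause is the invariant of Dijkstra's algorithm: whatever can still be settled costs at least
  as much as everything settled.\<close>

definition settled :: "(nat \<times> nat) list list \<Rightarrow> bool" where
  "settled S \<longleftrightarrow> [] \<in> set S \<and> (\<forall>e p. e # p \<in> set S \<longrightarrow> p \<in> set S \<and> within_limits I \<epsilon> (e # p)) \<and>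
     (\<forall>p\<in>set S. apath (start_vertex I p) p (target I)) \<and>
     sorted_wrt (\<lambda>b a. path_cost I a \<le> path_cost I b \<and> \<not> trim_dominates I \<epsilon> a b) S \<and>
     (\<forall>q\<in>candidates I es S. adm S q \<longrightarrow> (\<forall>a\<in>set S. path_cost I a \<le> path_cost I q))"

lemma settled_suffix: "settled S \<Longrightarrow> q @ r \<in> set S \<Longrightarrow> r \<in> set S"
  by (induction q) (auto simp: settled_def)

lemma settled_init: "settled [[]]"
proof -
  have "target I \<in> pverts (graph I)" using inst by (simp add: rcsp_instance_def)
  then show ?thesis
    using edge_cost_nonneg by (auto simp: settled_def apath_Nil_iff candidates_def)
qed

text \<open>The order of costs survives because an admissible candidate of the longer list either
  was one before, and then costs at least as much as the minimum \<open>q\<close>, or extends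
  \<open>q\<close> by an arc of nonnegative cost.\<close>

lemma settled_step:
  assumes S: "settled S"
    and q: "scan_labels I (trim I \<epsilon>) (limits I es \<epsilon>) es S S None = Some q"
  shows "settled (q # S)"
proof -
  from best_of_candidates[of S] have cand: "q \<in> candidates I es S" and adm: "adm S q"
    and least: "\<And>r. r \<in> candidates I es S \<Longrightarrow> adm S r \<Longrightarrow> path_cost I q \<le> path_cost I r"
    unfolding q by (auto simp: best_of_def)
  from cand obtain e p where ep: "q = e # p" "e \<in> set es" "p \<in> set S" "start_vertex I p = snd e"
    by (auto simp: candidates_def)
  from adm have lim: "within_limits I \<epsilon> q" and undom: "\<forall>a\<in>set S. \<not> trim_dominates I \<epsilon> a q"
    using admissible_iff[OF cand] by auto
  have apath: "apath (fst e) q (target I)"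
    unfolding ep(1)
  proof (rule extension_apath)
    show "apath (start_vertex I p) p (target I)" using S ep(3) unfolding settled_def by blast
    show "\<not> trim_dominates I \<epsilon> r (e # p)" if "p = l @ r" for l r
      using undom settled_suffix[OF S, of l r] that ep by auto
  qed (use ep in auto)
  have cheaper: "path_cost I a \<le> path_cost I q" if "a \<in> set S" for a
    using S cand adm that by (auto simp: settled_def)
  have "path_cost I a \<le> path_cost I r"
    if r: "r \<in> candidates I es (q # S)" "adm (q # S) r" and a: "a \<in> set (q # S)" for r a
  proof -
    \<comment> \<open>Adding labels can only create domination, so admissibility with respect to the
      longer list implies it with respect to \<open>S\<close>.\<close>
    have "adm S r" using r(2) by (auto simp: admissible_def dominated_def)
    show ?thesis
    proof (cases "r \<in> candidates I es S")
      case True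
      then show ?thesis
        using least[OF True \<open>adm S r\<close>] cheaper a by fastforce
    next
      case False
      then obtain e' where "r = e' # q" "e' \<in> set es"
        using r(1) by (auto simp: candidates_def)
      then show ?thesis
        using edge_cost_nonneg[of e'] cheaper a by fastforce
    qed
  qed
  then show ?thesis
    using S apath lim undom cheaper ep unfolding settled_def by auto
qed

text \<open>Induction from the target backwards. If \<open>a\<close> covers \<open>r\<close>, then
  \<open>e # a\<close> is a candidate within the limits; since the search has stopped, it is not
  admissible, so some settled \<open>b\<close> trim-dominates it at the price of one more
  \<open>\<eta> i\<close>. The prefix \<open>l\<close> is carried along to keep \<open>r\<close> a
  suffix of a feasible path, which is what puts \<open>e # a\<close> within the limits.\<close>

lemma settled_covers_suffix:
  assumes S: "settled S"
    and stop: "scan_labels I (trim I \<epsilon>) (limits I es \<epsilon>) es S S None = None"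
    and feas: "feasible I (l @ r)"
  shows "\<exists>a\<in>set S. start_vertex I a = start_vertex I r \<and> path_cost I a \<le> path_cost I r \<and>
    (\<forall>i<resources I. path_weight I i a \<le> path_weight I i r + real (length r) * \<eta> i)"
  using feas
proof (induction r arbitrary: l)
  case Nil
  then show ?case using S by (intro bexI[of _ "[]"]) (auto simp: settled_def)
next
  case (Cons e r)
  from Cons.IH[of "l @ [e]"] Cons.prems obtain a where a: "a \<in> set S"
      "start_vertex I a = start_vertex I r" "path_cost I a \<le> path_cost I r"
      "\<forall>i<resources I. path_weight I i a \<le> path_weight I i r + real (length r) * \<eta> i"
    by auto
  have path: "apath (source I) (l @ e # r) (target I)"
    using Cons.prems by (simp add: feasible_def st_path_def)
  then have l: "apath (source I) l (fst e)" and er: "apath (fst e) (e # r) (target I)"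
    by (auto simp: apath_append_iff apath_Cons_iff)
  then have e: "e \<in> set es" "start_vertex I r = snd e"
    using edges start_vertex_awalk[of "snd e" r] by (auto simp: apath_def awalk_Cons_iff)
  have cand: "e # a \<in> candidates I es S" using a e by (auto simp: candidates_def simp del: split_paired_Ex)
  have "length r < n" using length_apath_less[OF er] by simp
  \<comment> \<open>The whole path meets the budget and \<open>l\<close> weighs at least
    \<open>n * min_weight\<close>, so \<open>e # r\<close> weighs at most the budget minus that.
    Passing from \<open>r\<close> to \<open>a\<close> adds at most
    \<open>length r * \<eta> i\<close>, which the slack \<open>n * \<eta> i\<close> covers.\<close>
  have "within_limits I \<epsilon> (e # a)"
    unfolding within_limits_def
  proof (intro allI impI)
    fix i assume i: "i < resources I"
    have "path_weight I i (l @ e # r) \<le> budget I i" using Cons.prems i by (simp add: feasible_def)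
    moreover have "real n * min_weight I i \<le> path_weight I i l" by (rule path_weight_lower[OF l])
    moreover have "real (length r) * \<eta> i \<le> real n * \<eta> i"
      using \<open>length r < n\<close> cell_width_pos[OF i] by (intro mult_right_mono) auto
    moreover have "real n * \<eta> i = budget I i * \<epsilon> i" by (rule n_cell_width)
    ultimately show "path_weight I i (e # a) \<le>
        budget I i + budget I i * \<epsilon> i - real n * min_weight I i"
      using a(4) i by (fastforce simp: path_weight_append)
  qed
  moreover have "\<not> adm S (e # a)"
    using best_of_candidates[of S] cand unfolding stop by (auto simp: best_of_def)
  ultimately obtain b where b: "b \<in> set S" "trim_dominates I \<epsilon> b (e # a)"
    using admissible_iff[OF cand] by auto
  show ?case
  proof (intro bexI[OF _ b(1)] conjI allI impI)
    show "start_vertex I b = start_vertex I (e # r)" "path_cost I b \<le> path_cost I (e # r)"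
      using a b by (auto simp: trim_dominates_def)
    fix i assume i: "i < resources I"
    then have "path_weight I i b \<le> path_weight I i (e # a) + \<eta> i"
      using b by (simp add: trim_dominates_def)
    then show "path_weight I i b \<le> path_weight I i (e # r) + real (length (e # r)) * \<eta> i"
      using a(4) i by (fastforce simp: algebra_simps)
  qed
qed

text \<open>The label covering an entire optimal path meets the goal at cost at most the optimum,
  and the selected label is no more expensive than that one.\<close>

lemma select_approx_solution:
  assumes S: "settled S"
    and stop: "scan_labels I (trim I \<epsilon>) (limits I es \<epsilon>) es S S None = None"
    and feas: "\<exists>q. feasible I q"
  shows "approx_solution I \<epsilon> (select I (goal I \<epsilon>) S [])"
proof -
  let ?F = "{q. feasible I q}"
  have "rcsp_opt I \<in> path_cost I ` ?F"
    unfolding rcsp_opt_def using finite_feasible[OF inst] feas by (intro Min_in) auto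
  then obtain q where q: "feasible I q" "path_cost I q = rcsp_opt I" by auto
  have path: "apath (source I) q (target I)" using q by (simp add: feasible_def st_path_def)
  from settled_covers_suffix[OF S stop, of "[]" q] q obtain a where a: "a \<in> set S"
      "start_vertex I a = start_vertex I q" "path_cost I a \<le> rcsp_opt I"
      "\<forall>i<resources I. path_weight I i a \<le> path_weight I i q + real (length q) * \<eta> i"
    by auto
  have "leqs (label_vec I a) (goal I \<epsilon>)"
    unfolding leqs_goal
  proof (intro conjI allI impI)
    show "start_vertex I a = source I"
      using a(2) start_vertex_awalk path by (simp add: apath_def)
    fix i assume i: "i < resources I"
    have "real (length q) * \<eta> i \<le> real n * \<eta> i"
      using length_apath_less[OF path] cell_width_pos[OF i] by (intro mult_right_mono) auto
    moreover have "real n * \<eta> i = budget I i * \<epsilon> i" by (rule n_cell_width)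
    moreover have "path_weight I i q \<le> budget I i" using q i by (simp add: feasible_def)
    ultimately show "path_weight I i a \<le> budget I i + budget I i * \<epsilon> i"
      using a(4) i by fastforce
  qed
  moreover have "sorted_wrt (\<lambda>b a. path_cost I a \<le> path_cost I b) S"
    using S unfolding settled_def by (auto elim: sorted_wrt_mono_rel[rotated])
  ultimately have sel: "select I (goal I \<epsilon>) S [] \<in> set S"
      "leqs (label_vec I (select I (goal I \<epsilon>) S [])) (goal I \<epsilon>)"
      "path_cost I (select I (goal I \<epsilon>) S []) \<le> path_cost I a"
    using select_cheapest[of I S "goal I \<epsilon>" "[]"] a(1) by auto
  have "apath (start_vertex I (select I (goal I \<epsilon>) S [])) (select I (goal I \<epsilon>) S []) (target I)"
    using S sel(1) by (simp add: settled_def)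
  then show ?thesis
    using sel a(3) unfolding leqs_goal
    by (auto simp: approx_solution_def st_path_def algebra_simps)
qed

end

section \<open>Counting the settled labels\<close>

context rcsp_search
begin

text \<open>Labels are settled in order of cost, so of two labels in the same cell the later one would be
  dominated by the earlier one. Hence cells bound the number of settled labels, although the program
  never computes one (it has no floor operation).\<close>

definition cell :: "(nat \<times> nat) list \<Rightarrow> nat \<times> (nat \<Rightarrow> int)" where
  "cell p = (start_vertex I p, restrict (\<lambda>i. \<lfloor>path_weight I i p / \<eta> i\<rfloor>) {..<resources I})"

text \<open>The upper end uses the absolute value of the budget so that it is nonnegative and also
  includes the empty label, of weight 0, which is not subject to the limits.\<close>

definition cell_range :: "nat \<Rightarrow> int set" where
  "cell_range i = {\<lfloor>real n * min_weight I i / \<eta> i\<rfloor> ..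
     \<lfloor>(\<bar>budget I i\<bar> + budget I i * \<epsilon> i - real n * min_weight I i) / \<eta> i\<rfloor>}"

definition num_cells :: nat where
  "num_cells = n * (\<Prod>i<resources I. card (cell_range i))"

lemma same_cell_weight:
  assumes "cell p = cell q" "i < resources I"
  shows "path_weight I i p \<le> path_weight I i q + \<eta> i"
proof -
  have "\<lfloor>path_weight I i p / \<eta> i\<rfloor> = \<lfloor>path_weight I i q / \<eta> i\<rfloor>"
    using assms by (auto simp: cell_def dest!: fun_cong[of _ _ i])
  then have "path_weight I i p / \<eta> i \<le> path_weight I i q / \<eta> i + 1" by linarith
  also have "\<dots> = (path_weight I i q + \<eta> i) / \<eta> i"
    using cell_width_pos[OF assms(2)] by (simp add: add_divide_distrib)
  finally show ?thesis
    using cell_width_pos[OF assms(2)] by (simp add: divide_le_cancel)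
qed

lemma cell_in_range:
  assumes S: "settled S" and p: "p \<in> set S"
  shows "cell p \<in> {..<n} \<times> (\<Pi>\<^sub>E i\<in>{..<resources I}. cell_range i)"
proof -
  have path: "apath (start_vertex I p) p (target I)" using S p by (simp add: settled_def)
  then have "start_vertex I p \<in> pverts (graph I)"
    by (auto simp: apath_def intro: awalk_hd_in_verts)
  then have "start_vertex I p < n" using inst by (auto simp: rcsp_instance_def)
  moreover have "\<lfloor>path_weight I i p / \<eta> i\<rfloor> \<in> cell_range i" if i: "i < resources I" for i
  proof -
    have "path_weight I i p \<le> \<bar>budget I i\<bar> + budget I i * \<epsilon> i - real n * min_weight I i"
    proof (cases p)
      case Nil
      have "real n * min_weight I i \<le> 0"
        using min_weight_nonpos by (simp add: mult_nonneg_nonpos)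
      then show ?thesis using Nil slack_pos[OF i] by simp
    next
      case (Cons e r)
      then have "within_limits I \<epsilon> p" using S p unfolding settled_def by blast
      then show ?thesis using i by (fastforce simp: within_limits_def)
    qed
    then show ?thesis
      using path_weight_lower[OF path, of i] cell_width_pos[OF i]
      unfolding cell_range_def atLeastAtMost_iff
      by (intro conjI floor_mono divide_right_mono) auto
  qed
  ultimately show ?thesis by (auto simp: cell_def)
qed

lemma length_settled:
  assumes S: "settled S"
  shows "length S \<le> num_cells"
proof -
  have "sorted_wrt (\<lambda>b a. path_cost I a \<le> path_cost I b \<and> \<not> trim_dominates I \<epsilon> a b) S"
    using S by (simp add: settled_def)
  then have "sorted_wrt (\<lambda>b a. cell b \<noteq> cell a) S"
  proof (rule sorted_wrt_mono_rel[rotated])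
    fix b a assume *: "path_cost I a \<le> path_cost I b \<and> \<not> trim_dominates I \<epsilon> a b"
    show "cell b \<noteq> cell a"
    proof
      assume eq: "cell b = cell a"
      then have "start_vertex I a = start_vertex I b" by (simp add: cell_def)
      then show False
        using * same_cell_weight[OF eq[symmetric]] by (auto simp: trim_dominates_def)
    qed
  qed
  then have "distinct (map cell S)"
    by (induction S) auto
  then have "length S = card (cell ` set S)"
    by (metis distinct_card length_map set_map)
  also have "\<dots> \<le> card ({..<n} \<times> (\<Pi>\<^sub>E i\<in>{..<resources I}. cell_range i))"
  proof (rule card_mono)
    show "finite ({..<n} \<times> (\<Pi>\<^sub>E i\<in>{..<resources I}. cell_range i))"
      by (intro finite_cartesian_product finite_PiE) (auto simp: cell_range_def)
  qed (use cell_in_range[OF S] in blast)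
  also have "\<dots> = num_cells"
    by (simp add: card_cartesian_product card_PiE num_cells_def)
  finally show ?thesis .
qed

text \<open>Each round costs at most \<open>B\<close>, as \<open>num_cells\<close> bounds the number
  of labels throughout. The factor counts the labels that may still be added, plus one for the last
  scan, which finds nothing.\<close>

lemma settle_terminates:
  assumes "settled S"
  defines "B \<equiv> (20 * (resources I + 3) + 40) * (num_cells + 9) * (length es + 2) *
    (num_cells + 1) + 20"
  shows "\<exists>S'. settled S' \<and>
    scan_labels I (trim I \<epsilon>) (limits I es \<epsilon>) es S' S' None = None \<and>
    returns [enc_labels I S, enc_edges I es, enc_nums (trim I \<epsilon>), enc_nums (limits I es \<epsilon>)] 10
      (enc_labels I S') ((num_cells + 1 - length S) * B)"
  using assms(1)
proof (induction "num_cells - length S" arbitrary: S rule: less_induct)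
  case less
  let ?scan = "scan_labels I (trim I \<epsilon>) (limits I es \<epsilon>) es S S None"
  have le: "length S \<le> num_cells" by (rule length_settled[OF less.prems])
  have step: "(20 * (resources I + 3) + 40) * (length S + 9) * (length es + 2) * (length S + 1)
      + 20 \<le> B"
    unfolding B_def using le by (intro add_mono mult_le_mono order_refl) auto
  show ?case
  proof (cases ?scan)
    case None
    have "1 * B \<le> (num_cells + 1 - length S) * B" using le by (intro mult_le_mono) auto
    then have "B \<le> (num_cells + 1 - length S) * B" by (simp only: mult_1)
    then have "returns [enc_labels I S, enc_edges I es, enc_nums (trim I \<epsilon>),
        enc_nums (limits I es \<epsilon>)] 10 (enc_labels I S) ((num_cells + 1 - length S) * B)"
      by (rule within_mono[OF returns_settle_stop[OF length_vectors(5) None] order_trans[OF step]])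
    then show ?thesis using less.prems None by blast
  next
    case (Some q)
    have next_settled: "settled (q # S)" by (rule settled_step[OF less.prems Some])
    \<comment> \<open>Applying the count to the already extended list gives the strict inequality
      that makes the measure decrease.\<close>
    have lt: "length S < num_cells" using length_settled[OF next_settled] by simp
    then have "num_cells - length (q # S) < num_cells - length S" by simp
    from less.hyps[OF this next_settled] obtain S' where S': "settled S'"
      "scan_labels I (trim I \<epsilon>) (limits I es \<epsilon>) es S' S' None = None"
      "returns [enc_labels I (q # S), enc_edges I es, enc_nums (trim I \<epsilon>),
        enc_nums (limits I es \<epsilon>)] 10 (enc_labels I S') ((num_cells + 1 - length (q # S)) * B)"
      by blast
    have "num_cells + 1 - length S = Suc (num_cells + 1 - length (q # S))" using lt by simp
    then have "returns [enc_labels I S, enc_edges I es, enc_nums (trim I \<epsilon>),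
        enc_nums (limits I es \<epsilon>)] 10 (enc_labels I S') ((num_cells + 1 - length S) * B)"
      using step by (intro within_mono[OF returns_settle_step[OF length_vectors(5) Some S'(3)]]) simp
    then show ?thesis using S' by blast
  qed
qed

text \<open>With \<open>k = n\<close>, \<open>a\<close> and \<open>b\<close> the sizes of tolerance
  and budget, and \<open>c\<close> the condition number, the width is \<open>b * a / k\<close>.
  Measured in it, the interval has length \<open>k / a + k + 2 * k^2 * c / a\<close>, and rounding
  adds at most 2. A constant factor would turn into an \<open>m\<close>-th power in the product over
  all resources, so constants are absorbed into \<open>k ^ 4\<close>.\<close>

lemma card_cell_range:
  assumes n: "2 \<le> n" and i: "i < resources I"
  shows "real (card (cell_range i)) \<le>
    real n ^ 4 * ((1 + cond_number I i) * (1 + 1 / \<bar>\<epsilon> i\<bar>))"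
proof -
  define a b c k where "a = \<bar>\<epsilon> i\<bar>" and "b = \<bar>budget I i\<bar>" and "c = cond_number I i"
    and "k = real n"
  have L: "budget I i \<noteq> 0" using inst i by (simp add: rcsp_instance_def)
  have slack: "budget I i * \<epsilon> i = b * a"
    using slack_pos[OF i] by (simp add: a_def b_def abs_mult[symmetric])
  have pos: "0 < a" "0 < b" "0 \<le> c" "2 \<le> k"
    using slack_pos[OF i] L n by (auto simp: a_def b_def c_def k_def cond_number_def)
  have "c = \<bar>min_weight I i\<bar> / b" by (simp only: c_def b_def cond_number_def min_weight_def)
  then have low: "min_weight I i = - (c * b)"
    using min_weight_nonpos[of i] pos by (simp add: abs_of_nonpos)
  have \<eta>: "\<eta> i = b * a / k" by (simp add: cell_width_def slack k_def)
  have hi: "(b + b * a + k * (c * b)) / \<eta> i = k / a + k + k\<^sup>2 * c / a"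
    and lo: "- (k * (c * b)) / \<eta> i = - (k\<^sup>2 * c / a)"
    using pos unfolding \<eta> by (simp_all add: field_simps power2_eq_square)
  have floor_diff: "of_int (\<lfloor>x\<rfloor> - \<lfloor>- y\<rfloor> + 1) \<le> x + y + 2" for x y :: real
    by linarith
  have range: "cell_range i = {\<lfloor>- (k\<^sup>2 * c / a)\<rfloor> .. \<lfloor>k / a + k + k\<^sup>2 * c / a\<rfloor>}"
    using hi lo by (simp add: cell_range_def slack low b_def[symmetric] k_def[symmetric])
  have "- (k\<^sup>2 * c / a) \<le> k / a + k + k\<^sup>2 * c / a" using pos by (simp add: add_increasing)
  then have "\<lfloor>- (k\<^sup>2 * c / a)\<rfloor> \<le> \<lfloor>k / a + k + k\<^sup>2 * c / a\<rfloor>" by (rule floor_mono)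
  then have "real (card (cell_range i)) =
      of_int (\<lfloor>k / a + k + k\<^sup>2 * c / a\<rfloor> - \<lfloor>- (k\<^sup>2 * c / a)\<rfloor> + 1)"
    unfolding range by simp
  also have "\<dots> \<le> k / a + k + k\<^sup>2 * c / a + k\<^sup>2 * c / a + 2"
    by (rule floor_diff)
  also have "\<dots> = (k + 2) + k * (1 / a) + (2 * k\<^sup>2) * (c / a)" by simp
  also have "\<dots> \<le> k ^ 4 * 1 + k ^ 4 * (1 / a) + k ^ 4 * (c / a)"
  proof (intro add_mono mult_right_mono)
    \<comment> \<open>Here \<open>k \<ge> 2\<close> is essential: it yields
      \<open>4 * k^2 \<le> k^4\<close>, which dominates each of the coefficients
      \<open>k + 2\<close>, \<open>k\<close> and \<open>2 * k^2\<close>.\<close>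
    have sq: "k * 2 \<le> k\<^sup>2" "4 \<le> k\<^sup>2"
      using pos mult_left_mono[of 2 k k] power_mono[of 2 k 2] by (auto simp: power2_eq_square)
    have "k\<^sup>2 * 4 \<le> k\<^sup>2 * k\<^sup>2" using sq by (intro mult_left_mono) auto
    then have *: "4 * k\<^sup>2 \<le> k ^ 4" by (simp add: power_add[symmetric])
    show "k + 2 \<le> k ^ 4 * 1" "k \<le> k ^ 4" "2 * k\<^sup>2 \<le> k ^ 4" using * sq pos by linarith+
  qed (use pos in auto)
  also have "\<dots> \<le> k ^ 4 * ((1 + c) * (1 + 1 / a))"
    using pos by (simp add: algebra_simps add_divide_distrib)
  finally show ?thesis by (simp add: a_def c_def k_def)
qed

section \<open>All size parameters bounded by powers of \<open>poly_base\<close>\<close>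

lemma cond_number_nonneg: "0 \<le> cond_number I i"
  by (simp add: cond_number_def)

lemma factors_ge_1: "1 \<le> (1 + cond_number I i) * (1 + 1 / \<bar>\<epsilon> i\<bar>)"
proof -
  have "1 * 1 \<le> (1 + cond_number I i) * (1 + 1 / \<bar>\<epsilon> i\<bar>)"
    using cond_number_nonneg[of i] by (intro mult_mono) auto
  then show ?thesis by simp
qed

lemma poly_base_ge: "real (n ^ resources I) \<le> poly_base I \<epsilon>"
proof -
  have "1 \<le> (\<Prod>i<resources I. (1 + cond_number I i) * (1 + 1 / \<bar>\<epsilon> i\<bar>))"
    by (rule prod_ge_1) (rule factors_ge_1)
  then show ?thesis unfolding poly_base_def by (simp add: mult_le_cancel_left1)
qed

lemma poly_base_ge_1: "1 \<le> poly_base I \<epsilon>"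
proof -
  have "1 \<le> n ^ resources I" using n_pos by (simp add: Suc_le_eq)
  then have "1 \<le> real (n ^ resources I)" by linarith
  then show ?thesis using poly_base_ge by linarith
qed

lemma num_verts_le: "real n \<le> poly_base I \<epsilon>"
proof -
  have "n ^ 1 \<le> n ^ resources I"
    using n_pos inst by (intro power_increasing) (auto simp: rcsp_instance_def)
  then have "real n \<le> real (n ^ resources I)" by (simp only: of_nat_le_iff power_one_right)
  then show ?thesis using poly_base_ge by linarith
qed

text \<open>The number \<open>m\<close> of resources enters the running time as the length of the
  vectors, and \<open>m < 2 ^ m \<le> n ^ m\<close> pays for it. With a single vertex this
  fails.\<close>

lemma resources_le: "2 \<le> n \<Longrightarrow> real (resources I) \<le> poly_base I \<epsilon>"
proof -
  assume "2 \<le> n"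
  then have "resources I \<le> n ^ resources I"
    by (meson less_exp less_imp_le order_trans power_mono zero_le_numeral)
  then have "real (resources I) \<le> real (n ^ resources I)" by linarith
  then show ?thesis using poly_base_ge by linarith
qed

lemma num_cells_le:
  assumes "2 \<le> n"
  shows "real num_cells \<le> poly_base I \<epsilon> ^ 5"
proof -
  let ?f = "\<lambda>i. (1 + cond_number I i) * (1 + 1 / \<bar>\<epsilon> i\<bar>)"
  let ?F = "\<Prod>i<resources I. ?f i"
  have F: "1 \<le> ?F" by (rule prod_ge_1) (rule factors_ge_1)
  \<comment> \<open>A factor \<open>n ^ 4\<close> for each resource multiplies to
    \<open>(n ^ m) ^ 4\<close>, so the exponent 4 does not depend on \<open>m\<close>. The factor
    \<open>n\<close> for the start vertex then raises it to 5.\<close>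
  have "(\<Prod>i<resources I. real (card (cell_range i))) \<le> (\<Prod>i<resources I. real n ^ 4 * ?f i)"
    using card_cell_range[OF assms] by (intro prod_mono) auto
  also have "\<dots> = (real n ^ resources I) ^ 4 * ?F"
    by (simp add: prod.distrib power_mult[symmetric] mult.commute)
  also have "\<dots> \<le> (real n ^ resources I) ^ 4 * ?F ^ 4"
    using F by (intro mult_left_mono self_le_power) auto
  also have "\<dots> = poly_base I \<epsilon> ^ 4"
    by (simp add: poly_base_def power_mult_distrib)
  finally have "real n * (\<Prod>i<resources I. real (card (cell_range i))) \<le>
      poly_base I \<epsilon> * poly_base I \<epsilon> ^ 4"
    using num_verts_le poly_base_ge_1 by (intro mult_mono) (auto intro: prod_nonneg)
  then show ?thesis by (simp add: num_cells_def power_Suc[symmetric] del: power_Suc)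
qed

lemma card_arcs_le:
  assumes "distinct es"
  shows "real (length es) \<le> poly_base I \<epsilon> ^ 2"
proof -
  have "parcs (graph I) \<subseteq> {..<n} \<times> {..<n}"
    using in_arcsD1 in_arcsD2 inst by (auto simp: rcsp_instance_def)
  then have "card (parcs (graph I)) \<le> card ({..<n} \<times> {..<n})" by (intro card_mono) auto
  then have "length es \<le> n ^ 2"
    using distinct_card[OF assms] edges by (simp add: card_cartesian_product power2_eq_square)
  then have "real (length es) \<le> real n ^ 2" by (metis of_nat_le_iff of_nat_power)
  also have "\<dots> \<le> poly_base I \<epsilon> ^ 2" using num_verts_le by (intro power_mono) auto
  finally show ?thesis .
qed

text \<open>Write \<open>X\<close> for \<open>poly_base\<close>. There are at most
  \<open>X^5\<close> rounds, each of order \<open>X * X^5 * X^2 * X^5 = X^13\<close> (vector length,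
  labels tested, arcs, labels extended), which gives \<open>X^18\<close>; preparation and selection
  are of order \<open>X^6\<close>. The explicit constants 7220 and 1440 fit well below
  16000.\<close>

lemma runs_within:
  assumes "distinct es"
  shows "\<exists>v T. runs rcsp_program (enc_input I es \<epsilon>) v T \<and> real T \<le> 16000 * poly_base I \<epsilon> ^ 18 \<and>
    ((\<exists>q. feasible I q) \<longrightarrow> (\<exists>p. v = enc_path p \<and> approx_solution I \<epsilon> p))"
proof -
  let ?X = "poly_base I \<epsilon>"
  have X: "1 \<le> ?X" by (rule poly_base_ge_1)
  have "\<exists>p T. eval_within rcsp_program (enc_input I es \<epsilon>) main_body (enc_path p) T \<and>
    real T \<le> 16000 * ?X ^ 18 \<and> ((\<exists>q. feasible I q) \<longrightarrow> approx_solution I \<epsilon> p)"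
  proof (cases "n \<le> 1")
    case True
    \<comment> \<open>A simple path has fewer than \<open>n\<close> arcs, so the empty path returned
      by the program is the only possible feasible one.\<close>
    have "approx_solution I \<epsilon> []" if feas: "\<exists>q. feasible I q"
    proof -
      have "p = []" if "feasible I p" for p
      proof -
        have "length p < n"
          using length_apath_less that by (auto simp: feasible_def st_path_def)
        then have "length p = 0" using True by linarith
        then show ?thesis by simp
      qed
      then have F: "{q. feasible I q} = {[]}" using feas by auto
      then have f: "feasible I []" by auto
      have "budget I i \<le> (1 + \<epsilon> i) * budget I i" if "i < resources I" for i
        using slack_pos[OF that] by (simp add: algebra_simps)
      then show ?thesis
        using f F by (fastforce simp: approx_solution_def feasible_def rcsp_opt_def)
    qed
    moreover have "1 \<le> ?X ^ 18" using X by simp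
    ultimately show ?thesis using main_trivial[OF True] by (intro exI[of _ "[]"] exI[of _ 4]) auto
  next
    case False
    then have n: "2 \<le> n" by simp
    define N E M where "N = num_cells" and "E = length es" and "M = resources I"
    define B where "B = (20 * (M + 3) + 40) * (N + 9) * (E + 2) * (N + 1) + 20"
    from settle_terminates[OF settled_init] obtain S where S: "settled S"
      "scan_labels I (trim I \<epsilon>) (limits I es \<epsilon>) es S S None = None"
      "returns [enc_labels I [[]], enc_edges I es, enc_nums (trim I \<epsilon>), enc_nums (limits I es \<epsilon>)] 10
        (enc_labels I S) ((num_cells + 1 - length [[] :: (nat \<times> nat) list]) * B)"
      unfolding B_def N_def E_def M_def by blast
    define T where "T = (num_cells + 1 - length [[] :: (nat \<times> nat) list]) * B +
      (20 * (M + 3) + 40) * (E + length S + 10)"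
    have run: "eval_within rcsp_program (enc_input I es \<epsilon>) main_body
        (enc_path (select I (goal I \<epsilon>) S [])) T"
      using main_search[OF _ S(3)] n by (simp add: T_def M_def E_def)
    \<comment> \<open>The search starts with one settled label, so the count of rounds
      \<open>num_cells + 1 - 1\<close> is just \<open>N\<close>.\<close>
    have "T \<le> N * B + (20 * (M + 3) + 40) * (E + N + 10)"
      using length_settled[OF S(1)] by (simp add: T_def N_def)
    then have "real T \<le> real (N * B + (20 * (M + 3) + 40) * (E + N + 10))" by linarith
    also have "\<dots> = real N * ((20 * (real M + 3) + 40) * (real N + 9) * (real E + 2) * (real N + 1)
        + 20) + (20 * (real M + 3) + 40) * (real E + real N + 10)"
      unfolding B_def by (simp only: of_nat_add of_nat_mult of_nat_numeral of_nat_1)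
    also have "\<dots> \<le> 16000 * ?X ^ 18"
    proof -
      have N: "real N \<le> ?X ^ 5" unfolding N_def by (rule num_cells_le[OF n])
      have E: "real E \<le> ?X ^ 2" unfolding E_def by (rule card_arcs_le[OF assms])
      have M: "real M \<le> ?X" unfolding M_def by (rule resources_le[OF n])
      have pow: "1 \<le> ?X ^ k" for k using X by simp
      have "?X ^ 2 \<le> ?X ^ 5" using X by (intro power_increasing) auto
      have a: "20 * (real M + 3) + 40 \<le> 120 * ?X" using M X by simp
      have b: "real N + 9 \<le> 10 * ?X ^ 5" "real N + 1 \<le> 2 * ?X ^ 5" using N pow[of 5] by simp_all
      have c: "real E + 2 \<le> 3 * ?X ^ 2" using E pow[of 2] by simp
      have d: "real E + real N + 10 \<le> 12 * ?X ^ 5"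
        using E N pow[of 5] \<open>?X ^ 2 \<le> ?X ^ 5\<close> by simp
      have "(20 * (real M + 3) + 40) * (real N + 9) * (real E + 2) * (real N + 1) \<le>
          (120 * ?X) * (10 * ?X ^ 5) * (3 * ?X ^ 2) * (2 * ?X ^ 5)"
        using a b c X by (intro mult_mono) auto
      also have "\<dots> = 7200 * ?X ^ 13" by (simp add: power_numeral_reduce)
      finally have "(20 * (real M + 3) + 40) * (real N + 9) * (real E + 2) * (real N + 1) + 20 \<le>
          7220 * ?X ^ 13" using pow[of 13] by simp
      then have "real N * ((20 * (real M + 3) + 40) * (real N + 9) * (real E + 2) * (real N + 1)
          + 20) \<le> ?X ^ 5 * (7220 * ?X ^ 13)"
        using N X by (intro mult_mono) auto
      moreover have "?X ^ 5 * (7220 * ?X ^ 13) = 7220 * ?X ^ 18" by (simp add: power_numeral_reduce)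
      moreover have "(20 * (real M + 3) + 40) * (real E + real N + 10) \<le>
          (120 * ?X) * (12 * ?X ^ 5)"
        using a d X by (intro mult_mono) auto
      moreover have "(120 * ?X) * (12 * ?X ^ 5) = 1440 * ?X ^ 6" by (simp add: power_numeral_reduce)
      moreover have "?X ^ 6 \<le> ?X ^ 18" using X by (intro power_increasing) auto
      ultimately show ?thesis using pow[of 18] by linarith
    qed
    finally show ?thesis using run select_approx_solution[OF S(1,2)] by blast
  qed
  then obtain p T where pT: "eval_within rcsp_program (enc_input I es \<epsilon>) main_body (enc_path p) T"
    "real T \<le> 16000 * ?X ^ 18" "(\<exists>q. feasible I q) \<longrightarrow> approx_solution I \<epsilon> p"
    by blast
  then obtain T' where "T' \<le> T" "eval rcsp_program (enc_input I es \<epsilon>) main_body (enc_path p) T'"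
    by (auto simp: eval_within_def)
  then have "runs rcsp_program (enc_input I es \<epsilon>) (enc_path p) T'" "real T' \<le> 16000 * ?X ^ 18"
    using pT(2) by (auto simp: runs_def rcsp_program_nth)
  then show ?thesis using pT(3) by blast
qed

end

section \<open>The general bound, and its specialization to a fixed number of resources\<close>

lemma rcsp_program_approximates:
  assumes "rcsp_instance I" "tolerances I \<epsilon>"
  shows "approximates_within rcsp_program I \<epsilon> (16000 * poly_base I \<epsilon> ^ 18)"
  unfolding approximates_within_def
proof (intro allI impI)
  fix es assume es: "distinct es \<and> set es = parcs (graph I)"
  then interpret rcsp_search I es \<epsilon>
    using assms by unfold_locales auto
  show "\<exists>v T. runs rcsp_program (enc_input I es \<epsilon>) v T \<and> real T \<le> 16000 * poly_base I \<epsilon> ^ 18 \<and>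
    ((\<exists>q. feasible I q) \<longrightarrow> (\<exists>p. v = enc_path p \<and> approx_solution I \<epsilon> p))"
    using runs_within es by blast
qed

lemma approximates_within_mono:
  "approximates_within P I \<epsilon> A \<Longrightarrow> A \<le> B \<Longrightarrow> approximates_within P I \<epsilon> B"
  unfolding approximates_within_def by (meson order_trans)

text \<open>Each of the \<open>2 * m\<close> factors \<open>1 + x\<close> is at most
  \<open>(1 + \<bar>A\<bar>) * n ^ a\<close>, because \<open>1 \<le> n ^ a\<close> lets the summand
  1 be absorbed. For fixed \<open>m\<close> the result is a polynomial in \<open>n\<close>.\<close>

lemma poly_base_polynomial:
  assumes inst: "rcsp_instance I" and m: "resources I = m"
    and bounds: "\<And>i. i < m \<Longrightarrow> cond_number I i \<le> A * real (num_verts I) ^ a"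
      "\<And>i. i < m \<Longrightarrow> 1 / \<bar>\<epsilon> i\<bar> \<le> A * real (num_verts I) ^ a"
  shows "poly_base I \<epsilon> \<le> (1 + \<bar>A\<bar>) ^ (2 * m) * real (num_verts I) ^ (m + 2 * a * m)"
proof -
  let ?n = "num_verts I"
  let ?D = "(1 + \<bar>A\<bar>) * real ?n ^ a"
  have "source I \<in> {..<?n}" using inst unfolding rcsp_instance_def by metis
  then have "0 < ?n" by (cases ?n) simp_all
  then have "1 \<le> real ?n" by linarith
  then have "1 \<le> real ?n ^ a" by simp
  have le: "1 + x \<le> ?D" if "x \<le> A * real ?n ^ a" for x
  proof -
    have "x \<le> \<bar>A\<bar> * real ?n ^ a"
      using that by (smt (verit) \<open>1 \<le> real ?n ^ a\<close> mult_right_mono abs_ge_self)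
    then show ?thesis using \<open>1 \<le> real ?n ^ a\<close> by (simp add: distrib_right)
  qed
  have "(\<Prod>i<m. (1 + cond_number I i) * (1 + 1 / \<bar>\<epsilon> i\<bar>)) \<le> (\<Prod>i<m. ?D * ?D)"
  proof (intro prod_mono conjI mult_nonneg_nonneg mult_mono le)
    show "0 \<le> 1 + cond_number I i" for i by (simp add: cond_number_def)
  qed (use bounds in auto)
  then have "poly_base I \<epsilon> \<le> real (?n ^ m) * (\<Prod>i<m. ?D * ?D)"
    unfolding poly_base_def m by (rule mult_left_mono) simp
  also have "\<dots> = (1 + \<bar>A\<bar>) ^ (2 * m) * real ?n ^ (m + 2 * a * m)"
    by (simp add: power_mult_distrib power_mult power_add power2_eq_square)
  finally show ?thesis .
qed

theorem theorem1p13: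
  shows "\<exists>P :: program.
    (\<exists>(C :: real) (k :: nat). \<forall>I \<epsilon>. rcsp_instance I \<and> tolerances I \<epsilon> \<longrightarrow>
       approximates_within P I \<epsilon> (C * poly_base I \<epsilon> ^ k)) \<and>
    (\<forall>(m :: nat) (A :: real) (a :: nat). \<exists>(B :: real) (b :: nat). \<forall>I \<epsilon>.
       rcsp_instance I \<and> tolerances I \<epsilon> \<and> resources I = m \<and>
       (\<forall>i<m. cond_number I i \<le> A * real (num_verts I) ^ a \<and>
              1 / \<bar>\<epsilon> i\<bar> \<le> A * real (num_verts I) ^ a) \<longrightarrow>
       approximates_within P I \<epsilon> (B * real (num_verts I) ^ b))"
proof (intro exI[of _ rcsp_program] conjI allI)
  show "\<exists>(C :: real) (k :: nat). \<forall>I \<epsilon>. rcsp_instance I \<and> tolerances I \<epsilon> \<longrightarrow>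
      approximates_within rcsp_program I \<epsilon> (C * poly_base I \<epsilon> ^ k)"
    using rcsp_program_approximates by blast
  fix m a :: nat and A :: real
  let ?c = "(1 + \<bar>A\<bar>) ^ (2 * m)" and ?d = "m + 2 * a * m"
  have "approximates_within rcsp_program I \<epsilon>
      ((16000 * ?c ^ 18) * real (num_verts I) ^ (?d * 18))"
    if *: "rcsp_instance I \<and> tolerances I \<epsilon> \<and> resources I = m \<and>
       (\<forall>i<m. cond_number I i \<le> A * real (num_verts I) ^ a \<and>
              1 / \<bar>\<epsilon> i\<bar> \<le> A * real (num_verts I) ^ a)" for I \<epsilon>
  proof (rule approximates_within_mono[OF rcsp_program_approximates])
    have "0 \<le> poly_base I \<epsilon>"
      unfolding poly_base_def cond_number_def by (intro mult_nonneg_nonneg prod_nonneg) auto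
    then have "poly_base I \<epsilon> ^ 18 \<le> (?c * real (num_verts I) ^ ?d) ^ 18"
      using * by (intro power_mono poly_base_polynomial) auto
    then show "16000 * poly_base I \<epsilon> ^ 18 \<le> 16000 * ?c ^ 18 * real (num_verts I) ^ (?d * 18)"
      unfolding power_mult[of "real (num_verts I)" ?d 18] by (simp add: power_mult_distrib)
  qed (use * in auto)
  then show "\<exists>(B :: real) (b :: nat). \<forall>I \<epsilon>.
       rcsp_instance I \<and> tolerances I \<epsilon> \<and> resources I = m \<and>
       (\<forall>i<m. cond_number I i \<le> A * real (num_verts I) ^ a \<and>
              1 / \<bar>\<epsilon> i\<bar> \<le> A * real (num_verts I) ^ a) \<longrightarrow>
       approximates_within rcsp_program I \<epsilon> (B * real (num_verts I) ^ b)"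
    by blast
qed

end
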